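(* The projective symplectic group $S_6(5)$ is non-$FSZ_5$, and its Sylow $5$-subgroup is non-$FSZ_5$.
   Context: $\mathbb{N}$ denotes the positive integers. For a group $G$, $u,g\in G$ and $m\in\mathbb{N}$, define $G_m(u,g)=\{a\in G : a^m=(au^{-1})^m=g\}$. The group $G$ is $FSZ_m$ if and only if for all $g\in G$, all $u\in C_G(g)$, and all $n\in\mathbb{N}$ coprime to the order of $g$, one has $|G_m(u,g)|=|G_m(u,g^n)|$. "Non-$FSZ_m$" means not $FSZ_m$. $S_6(5)$ denotes the simple projective symplectic group $PSp_6(5)$, i.e. the quotient by its center of the symplectic group of $6\times 6$ matrices over the field with $5$ elements. *)

theory Defs
  imports
    "HOL-Algebra.Algebra"
    "HOL-Library.Cardinality"
    "Jordan_Normal_Form.Determinant"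
begin

definition centralizer :: "('g, 'b) monoid_scheme \<Rightarrow> 'g \<Rightarrow> 'g set" where
  "centralizer G g = {u \<in> carrier G. u \<otimes>\<^bsub>G\<^esub> g = g \<otimes>\<^bsub>G\<^esub> u}"

definition center :: "('g, 'b) monoid_scheme \<Rightarrow> 'g set" where
  "center G = {z \<in> carrier G. \<forall>x \<in> carrier G. z \<otimes>\<^bsub>G\<^esub> x = x \<otimes>\<^bsub>G\<^esub> z}"

definition FSZ_set :: "('g, 'b) monoid_scheme \<Rightarrow> nat \<Rightarrow> 'g \<Rightarrow> 'g \<Rightarrow> 'g set" where
  "FSZ_set G m u g =
     {a \<in> carrier G. a [^]\<^bsub>G\<^esub> m = g \<and> (a \<otimes>\<^bsub>G\<^esub> inv\<^bsub>G\<^esub> u) [^]\<^bsub>G\<^esub> m = g}"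

definition FSZ :: "nat \<Rightarrow> ('g, 'b) monoid_scheme \<Rightarrow> bool" where
  "FSZ m G \<longleftrightarrow>
     (\<forall>g \<in> carrier G. \<forall>u \<in> centralizer G g. \<forall>n::nat.
        n > 0 \<and> coprime n (group.ord G g) \<longrightarrow>
        card (FSZ_set G m u g) = card (FSZ_set G m u (g [^]\<^bsub>G\<^esub> n)))"

text \<open>Both \<open>FSZ\<close> and the next definition are meant for finite \<open>G\<close>, since \<open>card\<close> is \<open>0\<close> on
  infinite sets.\<close>

definition sylow_subgroup :: "nat \<Rightarrow> 'g set \<Rightarrow> ('g, 'b) monoid_scheme \<Rightarrow> bool" where
  "sylow_subgroup p P G \<longleftrightarrow>
     subgroup P G \<and> card P = p ^ multiplicity p (card (carrier G))"

text \<open>The matrix of the standard alternating form on a free module of rank \<open>2 * n\<close>.\<close>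

definition sp_form :: "nat \<Rightarrow> 'a :: comm_ring_1 mat" where
  "sp_form n = four_block_mat (0\<^sub>m n n) (1\<^sub>m n) (- 1\<^sub>m n) (0\<^sub>m n n)"

text \<open>The index \<open>n\<close> is half the matrix size: in the literature these groups are written
  \<open>Sp\<close> and \<open>PSp\<close> with subscript \<open>2 * n\<close>.\<close>

definition Sp :: "nat \<Rightarrow> 'a :: comm_ring_1 mat monoid" where
  "Sp n = \<lparr>carrier = {A \<in> carrier_mat (2 * n) (2 * n).
                       transpose_mat A * sp_form n * A = sp_form n},
           monoid.mult = (*), one = 1\<^sub>m (2 * n)\<rparr>"

definition PSp :: "nat \<Rightarrow> 'a :: comm_ring_1 mat set monoid" where
  "PSp n = Sp n Mod center (Sp n)"

lemma sp_form_carrier [simp]: "sp_form n \<in> carrier_mat (2 * n) (2 * n)"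
  unfolding sp_form_def mult_2 by (rule four_block_carrier_mat) auto

lemma sp_form_square: "- sp_form n * sp_form n = (1\<^sub>m (2 * n) :: 'a :: comm_ring_1 mat)"
proof -
  have "sp_form n * sp_form n = (- 1\<^sub>m (2 * n) :: 'a mat)"
    unfolding sp_form_def
    by (subst mult_four_block_mat[of _ n n _ n _ n _ _ n _ n])
       (auto simp: mult_2 intro!: eq_matI)
  then show ?thesis
    by (metis sp_form_carrier one_carrier_mat uminus_mult_left_mat carrier_matD
        uminus_uminus_mat)
qed

lemma group_Sp: "group (Sp n :: 'a :: field mat monoid)"
proof (rule groupI)
  let ?J = "sp_form n :: 'a mat" and ?G = "Sp n :: 'a mat monoid"
  have J: "?J \<in> carrier_mat (2 * n) (2 * n)" by simp
  show "x \<otimes>\<^bsub>?G\<^esub> y \<in> carrier ?G" if "x \<in> carrier ?G" "y \<in> carrier ?G" for x y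
  proof -
    from that have x: "x \<in> carrier_mat (2*n) (2*n)" and y: "y \<in> carrier_mat (2*n) (2*n)"
      and ex: "transpose_mat x * ?J * x = ?J" and ey: "transpose_mat y * ?J * y = ?J"
      by (auto simp: Sp_def)
    have "transpose_mat (x * y) * ?J * (x * y) = transpose_mat y * (transpose_mat x * ?J * x) * y"
      using x y by (simp add: transpose_mult assoc_mult_mat[of _ "2*n" "2*n" _ "2*n" _ "2*n"]
            mult_carrier_mat[of _ "2*n" "2*n" _ "2*n"])
    also have "\<dots> = ?J" by (simp add: ex ey)
    finally show ?thesis using x y by (simp add: Sp_def)
  qed
  show "\<one>\<^bsub>?G\<^esub> \<in> carrier ?G"
    using left_mult_one_mat[OF J] right_mult_one_mat[OF J] by (simp add: Sp_def)
  show "x \<otimes>\<^bsub>?G\<^esub> y \<otimes>\<^bsub>?G\<^esub> z = x \<otimes>\<^bsub>?G\<^esub> (y \<otimes>\<^bsub>?G\<^esub> z)"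
    if "x \<in> carrier ?G" "y \<in> carrier ?G" "z \<in> carrier ?G" for x y z
    using that by (auto simp: Sp_def intro: assoc_mult_mat)
  show "\<one>\<^bsub>?G\<^esub> \<otimes>\<^bsub>?G\<^esub> x = x" if "x \<in> carrier ?G" for x
    using that by (auto simp: Sp_def)
  show "\<exists>y\<in>carrier ?G. y \<otimes>\<^bsub>?G\<^esub> x = \<one>\<^bsub>?G\<^esub>" if "x \<in> carrier ?G" for x
  proof -
    from that have x: "x \<in> carrier_mat (2*n) (2*n)" and ex: "transpose_mat x * ?J * x = ?J"
      by (auto simp: Sp_def)
    define y where "y = - ?J * (transpose_mat x * ?J)"
    have y: "y \<in> carrier_mat (2*n) (2*n)"
      using carrier_matD[OF J] unfolding y_def by (intro carrier_matI) auto
    have "y * x = - ?J * (transpose_mat x * ?J * x)"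
      using x carrier_matD[OF J] unfolding y_def
      by (intro assoc_mult_mat[of _ "2*n" "2*n" _ "2*n" _ "2*n"] carrier_matI) auto
    then have yx: "y * x = 1\<^sub>m (2*n)" by (simp add: ex sp_form_square)
    then have xy: "x * y = 1\<^sub>m (2*n)" using mat_mult_left_right_inverse[OF y x] by simp
    have "transpose_mat y * ?J * y = transpose_mat y * (transpose_mat x * ?J * x) * y"
      by (simp add: ex)
    also have "\<dots> = transpose_mat (x * y) * ?J * (x * y)"
      using x y by (simp add: transpose_mult assoc_mult_mat[of _ "2*n" "2*n" _ "2*n" _ "2*n"]
            mult_carrier_mat[of _ "2*n" "2*n" _ "2*n"])
    also have "\<dots> = ?J"
      using left_mult_one_mat[OF J] right_mult_one_mat[OF J] by (simp add: xy)
    finally show ?thesis using y yx by (auto simp: Sp_def)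
  qed
qed

lemma normal_center:
  assumes "group G"
  shows "center G \<lhd> G"
proof -
  interpret group G by fact
  have inv_central: "inv\<^bsub>G\<^esub> a \<otimes>\<^bsub>G\<^esub> x = x \<otimes>\<^bsub>G\<^esub> inv\<^bsub>G\<^esub> a"
    if "a \<in> center G" "x \<in> carrier G" for a x
  proof -
    have a: "a \<in> carrier G" and ax: "a \<otimes>\<^bsub>G\<^esub> x = x \<otimes>\<^bsub>G\<^esub> a"
      using that by (auto simp: center_def)
    have "inv\<^bsub>G\<^esub> a \<otimes>\<^bsub>G\<^esub> (x \<otimes>\<^bsub>G\<^esub> a) \<otimes>\<^bsub>G\<^esub> inv\<^bsub>G\<^esub> a = x \<otimes>\<^bsub>G\<^esub> inv\<^bsub>G\<^esub> a"
      unfolding ax[symmetric] using a that(2) by (simp add: m_assoc[symmetric])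
    then show ?thesis using a that(2) by (simp add: m_assoc)
  qed
  have sub: "subgroup (center G) G"
  proof (rule subgroupI)
    show "inv\<^bsub>G\<^esub> a \<in> center G" if "a \<in> center G" for a
      using that inv_central by (auto simp: center_def)
    show "a \<otimes>\<^bsub>G\<^esub> b \<in> center G" if "a \<in> center G" "b \<in> center G" for a b
    proof -
      have ab: "a \<in> carrier G" "b \<in> carrier G" using that by (auto simp: center_def)
      have "a \<otimes>\<^bsub>G\<^esub> b \<otimes>\<^bsub>G\<^esub> x = x \<otimes>\<^bsub>G\<^esub> (a \<otimes>\<^bsub>G\<^esub> b)" if x: "x \<in> carrier G" for x
      proof -
        have "a \<otimes>\<^bsub>G\<^esub> b \<otimes>\<^bsub>G\<^esub> x = a \<otimes>\<^bsub>G\<^esub> (b \<otimes>\<^bsub>G\<^esub> x)" using ab x by (simp add: m_assoc)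
        also have "b \<otimes>\<^bsub>G\<^esub> x = x \<otimes>\<^bsub>G\<^esub> b"
          using \<open>b \<in> center G\<close> x by (simp add: center_def)
        also have "a \<otimes>\<^bsub>G\<^esub> (x \<otimes>\<^bsub>G\<^esub> b) = (a \<otimes>\<^bsub>G\<^esub> x) \<otimes>\<^bsub>G\<^esub> b" using ab x by (simp add: m_assoc)
        also have "a \<otimes>\<^bsub>G\<^esub> x = x \<otimes>\<^bsub>G\<^esub> a"
          using \<open>a \<in> center G\<close> x by (simp add: center_def)
        finally show ?thesis using ab x by (simp add: m_assoc)
      qed
      then show ?thesis using ab by (simp add: center_def)
    qed
  qed (auto simp: center_def intro!: exI[of _ "\<one>\<^bsub>G\<^esub>"])
  have "x \<otimes>\<^bsub>G\<^esub> h \<otimes>\<^bsub>G\<^esub> inv\<^bsub>G\<^esub> x \<in> center G" if x: "x \<in> carrier G" and h: "h \<in> center G" for x h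
  proof -
    have hG: "h \<in> carrier G" and "x \<otimes>\<^bsub>G\<^esub> h = h \<otimes>\<^bsub>G\<^esub> x"
      using x h by (auto simp: center_def)
    then have "x \<otimes>\<^bsub>G\<^esub> h \<otimes>\<^bsub>G\<^esub> inv\<^bsub>G\<^esub> x = h"
      using x by (simp add: m_assoc)
    then show ?thesis using h by simp
  qed
  then show ?thesis
    unfolding normal_inv_iff using sub by blast
qed

lemma group_PSp: "group (PSp n :: 'a :: field mat set monoid)"
  unfolding PSp_def by (intro normal.factorgroup_is_group normal_center group_Sp)

end

(* Let V be the space of column vectors of length 6 over the field with 5 elements, with standard basis
   e_0, ..., e_5. Put E(c) = corner_mat c and L = log_mat; then g = 1 + E(c) is a transvection along e_0,
   and u = 1 + L commutes with it. A fifth root A of g in Sp is unipotent with a single Jordan block,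
   N = A - 1 satisfies N^5 = E(c), and V has the basis N^j e_3 with j < 6. If A u^-1 is a fifth root of g as
   well, then N and N' = A u^-1 - 1 are both similar to the shift matrix, so N' and N'^2 have trace 0. This
   puts e_2 into the kernel of N^3, and then N' is strictly triangular in the basis N^j e_3, with
   N'^5 = (1 + y)^2 (1 - 2 c x^2) N^5, where x vanishes iff N e_2 is a multiple of e_0, and then y = 0.
   For c = 2 this forces x = 0, whereas for c = 1 there are further solutions. The solutions with x = 0 for
   c = 1 and for c = 2 are exchanged by conjugation with a symplectic similitude of multiplier 3. Hence
   u, g and n = 2 refute FSZ_5, in the quotient modulo the center because a root of the class of g has a
   unique lift that is a root of g. Inside the unitriangular group there are solutions for c = 1 only, and
   every Sylow 5-subgroup is conjugate to that group: one of its elements fixes exactly one coset of the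
   Borel subgroup, so the number of these cosets is 1 modulo 5. *)

theory Submission
  imports Defs
begin

section \<open>Sylow subgroups and transport of the FSZ property\<close>

text \<open>Only an inequality between two counts is needed, so no root is counted and no group
  order is computed. The obstacle is that the similitude does not commute with u. It still acts on
  the solutions with x = 0, because the condition that N e_2 is a multiple of e_0 does not involve
  u. The two parts of L have different tasks. The long root part e_5 -> 2 e_2 yields the trace
  conditions on e_2 and the factor 1 - 2 c x^2; the short root part e_1 -> e_0, e_3 -> - e_4 yields
  (1 + y)^2, one factor for each of its entries. Over 5 elements (1 + y)^2 is 0, 1 or -1, while 1 -
  2 c x^2 with nonzero x is -1 or 3 for c = 1, but 2 or 0 for c = 2. So the product can be 1 for c =
  1, with (1 + y)^2 = -1, and the matrix \<open>regular_mat\<close> realises this; for c = 2 it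
  cannot. The exponent n = 2 is a nonsquare modulo 5, so g and g^2 are transvections of different
  classes.\<close>

lemma (in group) card_FSZ_set_iso:
  assumes "group H" "\<phi> \<in> iso G H" "u \<in> carrier G" "g \<in> carrier G"
  shows "card (FSZ_set H m (\<phi> u) (\<phi> g)) = card (FSZ_set G m u g)"
proof -
  interpret gh: group_hom G H \<phi>
    using assms by (simp add: group_hom_def group_hom_axioms_def iso_def is_group)
  have bij: "bij_betw \<phi> (carrier G) (carrier H)" using assms by (simp add: iso_def)
  have key: "\<phi> a \<in> FSZ_set H m (\<phi> u) (\<phi> g) \<longleftrightarrow> a \<in> FSZ_set G m u g" if "a \<in> carrier G" for a
  proof -
    have "(\<phi> a [^]\<^bsub>H\<^esub> m = \<phi> g) = (a [^] m = g)"
      using that assms bij gh.hom_nat_pow[of a m] by (metis bij_betw_def inj_on_eq_iff nat_pow_closed)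
    moreover have "((\<phi> a \<otimes>\<^bsub>H\<^esub> inv\<^bsub>H\<^esub> \<phi> u) [^]\<^bsub>H\<^esub> m = \<phi> g) = ((a \<otimes> inv u) [^] m = g)"
    proof -
      have "(\<phi> a \<otimes>\<^bsub>H\<^esub> inv\<^bsub>H\<^esub> \<phi> u) [^]\<^bsub>H\<^esub> m = \<phi> ((a \<otimes> inv u) [^] m)"
        using that assms gh.hom_nat_pow[of "a \<otimes> inv u" m] by simp
      then show ?thesis using that assms bij
        by (metis bij_betw_def inj_on_eq_iff nat_pow_closed m_closed inv_closed)
    qed
    ultimately show ?thesis using that by (simp add: FSZ_set_def)
  qed
  have "bij_betw \<phi> (FSZ_set G m u g) (FSZ_set H m (\<phi> u) (\<phi> g))"
  proof (rule bij_betw_imageI)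
    show "inj_on \<phi> (FSZ_set G m u g)"
      using bij by (auto simp: bij_betw_def FSZ_set_def intro: inj_on_subset)
    show "\<phi> ` FSZ_set G m u g = FSZ_set H m (\<phi> u) (\<phi> g)"
    proof
      show "\<phi> ` FSZ_set G m u g \<subseteq> FSZ_set H m (\<phi> u) (\<phi> g)"
        using key by (auto simp: FSZ_set_def[of G])
      show "FSZ_set H m (\<phi> u) (\<phi> g) \<subseteq> \<phi> ` FSZ_set G m u g"
      proof
        fix b assume b: "b \<in> FSZ_set H m (\<phi> u) (\<phi> g)"
        then obtain a where "a \<in> carrier G" "b = \<phi> a"
          using bij by (auto simp: FSZ_set_def bij_betw_def)
        then show "b \<in> \<phi> ` FSZ_set G m u g" using key b by blast
      qed
    qed
  qed
  then show ?thesis by (simp add: bij_betw_same_card)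
qed

text \<open>A Sylow subgroup is known only up to conjugation. Failure of the property is therefore
  shown once, for the unitriangular group, and carried over along an isomorphism.\<close>

lemma (in group) not_FSZ_iso:
  assumes "group H" "\<phi> \<in> iso G H" "\<not> FSZ m G"
  shows "\<not> FSZ m H"
proof -
  interpret gh: group_hom G H \<phi>
    using assms by (simp add: group_hom_def group_hom_axioms_def iso_def is_group)
  obtain g u and n :: nat where g: "g \<in> carrier G" and u: "u \<in> centralizer G g"
    and n: "n > 0" "coprime n (ord g)"
    and ne: "card (FSZ_set G m u g) \<noteq> card (FSZ_set G m u (g [^] n))"
    using assms(3) unfolding FSZ_def by blast
  have uG: "u \<in> carrier G" using u by (simp add: centralizer_def)
  have "\<phi> g [^]\<^bsub>H\<^esub> ord g = \<one>\<^bsub>H\<^esub>"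
    using g gh.hom_nat_pow[of g "ord g"] by simp
  then have "group.ord H (\<phi> g) dvd ord g"
    using g by (simp add: gh.H.pow_eq_id)
  then have ord: "coprime n (group.ord H (\<phi> g))" using n by (metis coprime_divisors dvd_refl)
  have "\<phi> u \<in> centralizer H (\<phi> g)"
    using u g by (auto simp: centralizer_def simp flip: gh.hom_mult)
  moreover have "\<phi> g \<in> carrier H" using g by simp
  moreover have "card (FSZ_set H m (\<phi> u) (\<phi> g)) \<noteq> card (FSZ_set H m (\<phi> u) (\<phi> g [^]\<^bsub>H\<^esub> n))"
    using ne card_FSZ_set_iso[OF assms(1,2) uG] g by (metis gh.hom_nat_pow nat_pow_closed)
  ultimately show ?thesis using n ord unfolding FSZ_def by blast
qed

section \<open>The fixed point congruence and conjugacy of Sylow subgroups\<close>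

lemma (in group_action) card_fixed_points_mod:
  assumes p: "Factorial_Ring.prime (p::nat)" and ord: "Coset.order G = p ^ k" and E: "finite E"
  shows "card {x \<in> E. \<forall>g \<in> carrier G. \<phi> g x = x} mod p = card E mod p"
proof -
  interpret G: group G using group_hom by (simp add: group_hom_def)
  let ?F = "{x \<in> E. \<forall>g \<in> carrier G. \<phi> g x = x}"
  have self: "x \<in> orbit G \<phi> x" if "x \<in> E" for x by (rule orbit_refl[OF that])
  have orbE: "orbit G \<phi> x \<subseteq> E" if "x \<in> E" for x
    using that element_image by (auto simp: orbit_def)
  \<comment> \<open>The indicator of the non-fixed points is summed orbit by orbit. An orbit of size
    1 contributes 0; any other orbit contains no fixed point and contributes its size, a positive
    power of \<open>p\<close>.\<close>
  have dv: "p dvd (\<Sum>x\<in>orb. if x \<in> ?F then 0 else 1 :: nat)" if orb: "orb \<in> orbits G E \<phi>" for orb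
  proof -
    obtain x where x: "x \<in> E" "orb = orbit G \<phi> x" using orb by (auto simp: orbits_def)
    have fin: "finite orb" using x orbE E finite_subset by blast
    show ?thesis
    proof (cases "card orb = 1")
      case True
      then have orbx: "orb = {x}" using self[OF x(1)] x(2) by (auto simp: card_1_singleton_iff)
      then have "x \<in> ?F" using x by (auto simp: orbit_def)
      then show ?thesis using orbx by simp
    next
      case False
      have "card orb dvd p ^ k" using orbit_stabilizer_theorem[OF x(1)] x(2) ord by (metis dvd_triv_left)
      then obtain i where i: "card orb = p ^ i" using divides_primepow_nat[OF p] by blast
      then have "p dvd card orb" using False by (cases i) auto
      moreover have "y \<notin> ?F" if y: "y \<in> orb" for y
      proof
        assume yF: "y \<in> ?F"
        have "x \<in> orbit G \<phi> y" using x y yF orbit_sym by blast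
        then have "x = y" using yF by (auto simp: orbit_def)
        then have "orb = {x}" using yF x by (auto simp: orbit_def intro: exI[of _ "\<one>"])
        then show False using False by simp
      qed
      then have "(\<Sum>x\<in>orb. if x \<in> ?F then 0 else 1 :: nat) = (\<Sum>x\<in>orb. 1)"
        by (intro sum.cong[OF refl]) (rule if_not_P)
      then have "(\<Sum>x\<in>orb. if x \<in> ?F then 0 else 1 :: nat) = card orb" by simp
      ultimately show ?thesis by metis
    qed
  qed
  have "(\<Sum>x\<in>E. if x \<in> ?F then 0 else 1 :: nat)
      = (\<Sum>orb\<in>orbits G E \<phi>. \<Sum>x\<in>orb. if x \<in> ?F then 0 else 1)"
    by (rule disjoint_sum[OF E, symmetric])
  also have "p dvd \<dots>" by (rule dvd_sum) (rule dv)
  also have "(\<Sum>x\<in>E. if x \<in> ?F then 0 else 1 :: nat) = (\<Sum>x\<in>E - ?F. 1)"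
    using E by (intro sum.mono_neutral_cong_right) auto
  also have "\<dots> = card (E - ?F)" by simp
  also have "\<dots> = card E - card ?F" using E by (intro card_Diff_subset) auto
  finally have "p dvd card E - card ?F" .
  moreover have "card ?F \<le> card E" using E by (intro card_mono) auto
  ultimately show ?thesis using mod_eq_dvd_iff_nat[of "card ?F" "card E" p] by simp
qed

text \<open>The inverse in \<open>R #> inv h\<close> turns right multiplication of right cosets into
  a left action, and the restriction to \<open>rcosets B\<close> makes each map extensional, as
  membership in \<open>BijGroup\<close> demands.\<close>

lemma (in group) coset_action:
  assumes "subgroup H G" "subgroup B G"
  shows "group_action (G\<lparr>carrier := H\<rparr>) (rcosets B) (\<lambda>h. \<lambda>R \<in> rcosets B. R #> inv h)"
proof -
  interpret H: group "G\<lparr>carrier := H\<rparr>" using assms(1) by (rule subgroup_imp_group)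
  interpret B: subgroup B G by fact
  have Hc: "h \<in> carrier G" if "h \<in> H" for h using subgroup.mem_carrier[OF assms(1) that] .
  have im: "R #> h \<in> rcosets B" if "R \<in> rcosets B" "h \<in> carrier G" for R h
    using that B.subset by (auto simp: RCOSETS_def coset_mult_assoc)
  have assoc: "R #> x #> y = R #> (x \<otimes> y)" if "R \<in> rcosets B" "x \<in> carrier G" "y \<in> carrier G" for R x y
    using that B.rcosets_carrier[OF is_group] by (intro coset_mult_assoc) auto
  have one: "R #> \<one> = R" if "R \<in> rcosets B" for R
    using that B.rcosets_carrier[OF is_group] by (intro coset_mult_one) auto
  have bij: "(\<lambda>R \<in> rcosets B. R #> inv h) \<in> carrier (BijGroup (rcosets B))" if h: "h \<in> H" for h
  proof -
    have "bij_betw (\<lambda>R \<in> rcosets B. R #> inv h) (rcosets B) (rcosets B)"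
      using Hc[OF h] by (intro bij_betw_byWitness[where f' = "\<lambda>R. R #> h"]) (auto simp: im assoc one)
    then show ?thesis by (simp add: BijGroup_def Bij_def)
  qed
  show ?thesis
    unfolding group_action_def group_hom_def group_hom_axioms_def
  proof (intro conjI H.is_group group_BijGroup homI)
    fix x y assume "x \<in> carrier (G\<lparr>carrier := H\<rparr>)" "y \<in> carrier (G\<lparr>carrier := H\<rparr>)"
    then have xy: "x \<in> H" "y \<in> H" by auto
    show "(\<lambda>R\<in>rcosets B. R #> inv (x \<otimes>\<^bsub>G\<lparr>carrier := H\<rparr>\<^esub> y)) =
      (\<lambda>R\<in>rcosets B. R #> inv x) \<otimes>\<^bsub>BijGroup (rcosets B)\<^esub> (\<lambda>R\<in>rcosets B. R #> inv y)"
      using bij[OF xy(1)] bij[OF xy(2)] Hc[OF xy(1)] Hc[OF xy(2)]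
      by (auto simp: BijGroup_def compose_def fun_eq_iff restrict_def im assoc inv_mult_group)
  qed (use bij in auto)
qed

lemma (in group) coset_fixed_iff:
  assumes "subgroup B G" "x \<in> carrier G" "h \<in> carrier G"
  shows "B #> x #> inv h = B #> x \<longleftrightarrow> x \<otimes> h \<otimes> inv x \<in> B"
proof -
  have sB: "B \<subseteq> carrier G" using assms(1) by (rule subgroup.subset)
  have "B #> x #> inv h = B #> x \<longleftrightarrow> B #> (x \<otimes> inv h) = B #> x"
    using assms sB by (simp add: coset_mult_assoc)
  also have "\<dots> \<longleftrightarrow> x \<otimes> inv (x \<otimes> inv h) \<in> B"
  proof
    assume "B #> (x \<otimes> inv h) = B #> x"
    then have "x \<in> B #> (x \<otimes> inv h)" using rcos_self[OF assms(2,1)] by simp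
    then obtain b where b: "b \<in> B" "x = b \<otimes> (x \<otimes> inv h)" by (auto simp: r_coset_def)
    then have "x \<otimes> inv (x \<otimes> inv h) = b"
      using assms sB by (metis inv_closed inv_solve_right m_closed subsetD)
    then show "x \<otimes> inv (x \<otimes> inv h) \<in> B" using b by simp
  next
    let ?b = "x \<otimes> inv (x \<otimes> inv h)"
    assume b: "?b \<in> B"
    have "B #> (x \<otimes> inv h) = (B #> ?b) #> (x \<otimes> inv h)"
      using coset_join2[OF _ assms(1) b] b sB by auto
    also have "\<dots> = B #> (?b \<otimes> (x \<otimes> inv h))"
      using b sB assms by (intro coset_mult_assoc) auto
    also have "?b \<otimes> (x \<otimes> inv h) = x" using assms by (simp add: m_assoc)
    finally show "B #> (x \<otimes> inv h) = B #> x" .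
  qed
  also have "x \<otimes> inv (x \<otimes> inv h) = x \<otimes> h \<otimes> inv x"
    using assms by (simp add: inv_mult_group m_assoc)
  finally show ?thesis .
qed

text \<open>A coset of \<open>x\<close> is fixed by \<open>H\<close> exactly if \<open>x\<close>
  conjugates \<open>H\<close> into \<open>B\<close>, so the fixed point congruence counts the
  conjugating elements modulo \<open>B\<close>.\<close>

lemma (in group) card_conjugating_cosets_mod:
  assumes "finite (carrier G)" "Factorial_Ring.prime (p::nat)" "subgroup H G" "card H = p ^ k" "subgroup B G"
  shows "card ((\<lambda>x. B #> x) ` {x \<in> carrier G. \<forall>h \<in> H. x \<otimes> h \<otimes> inv x \<in> B}) mod p
       = card (rcosets B) mod p"
proof -
  interpret A: group_action "G\<lparr>carrier := H\<rparr>" "rcosets B" "\<lambda>h. \<lambda>R \<in> rcosets B. R #> inv h"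
    by (rule coset_action[OF assms(3,5)])
  have "finite (rcosets B)" using assms(1) by (simp add: RCOSETS_def)
  then have "card {R \<in> rcosets B. \<forall>h \<in> H. R #> inv h = R} mod p = card (rcosets B) mod p"
    using A.card_fixed_points_mod[of p k] assms(2,4)
    by (simp add: Coset.order_def restrict_def cong: conj_cong)
  moreover have "{R \<in> rcosets B. \<forall>h \<in> H. R #> inv h = R}
      = (\<lambda>x. B #> x) ` {x \<in> carrier G. \<forall>h \<in> H. x \<otimes> h \<otimes> inv x \<in> B}"
    using coset_fixed_iff[OF assms(5)] subgroup.mem_carrier[OF assms(3)]
    by (auto simp: RCOSETS_def)
  ultimately show ?thesis by simp
qed

text \<open>By \<open>norm\<close> and \<open>QB\<close> the only coset fixed by \<open>Q\<close> is
  \<open>B\<close>, so the number of cosets is 1 modulo \<open>p\<close>. Read for \<open>P\<close>,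
  the same congruence gives a fixed coset, that is, a conjugate of \<open>P\<close> inside
  \<open>B\<close>. By \<open>elts\<close> this conjugate lies in \<open>Q\<close>, and the order of
  \<open>P\<close> leaves no room for a proper inclusion. The exponent \<open>k\<close> stays
  unspecified: that \<open>Q\<close> is itself a Sylow subgroup comes out of the argument.\<close>

lemma (in group) sylow_conjugate:
  assumes fin: "finite (carrier G)" and p: "Factorial_Ring.prime (p::nat)" and Q: "subgroup Q G" and cQ: "card Q = p ^ k"
    and B: "subgroup B G" and P: "sylow_subgroup p P G"
    and norm: "\<And>x. x \<in> carrier G \<Longrightarrow> (\<And>h. h \<in> Q \<Longrightarrow> x \<otimes> h \<otimes> inv x \<in> B) \<Longrightarrow> x \<in> B"
    and QB: "Q \<subseteq> B"
    and elts: "\<And>x n. x \<in> B \<Longrightarrow> x [^] (p ^ n) = \<one> \<Longrightarrow> x \<in> Q"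
  obtains x where "x \<in> carrier G" "(\<lambda>h. inv x \<otimes> h \<otimes> x) ` Q = P"
proof -
  have PG: "subgroup P G" and cP: "card P = p ^ multiplicity p (Coset.order G)"
    using P by (auto simp: sylow_subgroup_def Coset.order_def)
  interpret P: subgroup P G by fact
  interpret GP: group "G\<lparr>carrier := P\<rparr>" using PG by (rule subgroup_imp_group)
  have ordpos: "Coset.order G \<noteq> 0" using fin one_closed by (auto simp: Coset.order_def)
  have "(\<lambda>x. B #> x) ` {x \<in> carrier G. \<forall>h \<in> Q. x \<otimes> h \<otimes> inv x \<in> B} = {B}"
  proof -
    have "B #> x = B" if "x \<in> carrier G" "\<forall>h \<in> Q. x \<otimes> h \<otimes> inv x \<in> B" for x
      using norm[of x] that B by (simp add: coset_join2)
    moreover have "\<one> \<otimes> h \<otimes> inv \<one> \<in> B" if "h \<in> Q" for h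
      using that QB subgroup.mem_carrier[OF B] by (simp add: subset_iff)
    ultimately show ?thesis
      by (auto simp: image_iff intro!: exI[of _ "\<one>"])
  qed
  then have "card (rcosets B) mod p = 1 mod p"
    using card_conjugating_cosets_mod[OF fin p Q cQ B] by simp
  \<comment> \<open>The congruence is now read in the other direction: a number that is 1 modulo
    \<open>p\<close> is not 0.\<close>
  then have "card ((\<lambda>x. B #> x) ` {x \<in> carrier G. \<forall>h \<in> P. x \<otimes> h \<otimes> inv x \<in> B}) mod p = 1 mod p"
    using card_conjugating_cosets_mod[OF fin p PG cP B] by simp
  then have "{x \<in> carrier G. \<forall>h \<in> P. x \<otimes> h \<otimes> inv x \<in> B} \<noteq> {}"
    using prime_gt_1_nat[OF p] by (metis card.empty image_empty mod_0 mod_less zero_neq_one)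
  then obtain x where x: "x \<in> carrier G" "\<And>h. h \<in> P \<Longrightarrow> x \<otimes> h \<otimes> inv x \<in> B" by blast
  have conj_pow: "(x \<otimes> h \<otimes> inv x) [^] (n::nat) = x \<otimes> h [^] n \<otimes> inv x" if "h \<in> carrier G" for h n
  proof (induction n)
    case (Suc n)
    have "inv x \<otimes> (x \<otimes> (h \<otimes> inv x)) = h \<otimes> inv x"
      using x that by (simp flip: m_assoc)
    then show ?case using Suc x that by (simp add: m_assoc)
  qed (use x in simp)
  have sub: "(\<lambda>h. x \<otimes> h \<otimes> inv x) ` P \<subseteq> Q"
  proof clarify
    fix h assume h: "h \<in> P"
    have hG: "h \<in> carrier G" using h by simp
    have "h [^] card P = \<one>"
      using GP.pow_order_eq_1[of h] h nat_pow_consistent[of h "card P" P] by (simp add: Coset.order_def)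
    then have "(x \<otimes> h \<otimes> inv x) [^] (p ^ multiplicity p (Coset.order G)) = \<one>"
      using conj_pow[OF hG] x cP by simp
    then show "x \<otimes> h \<otimes> inv x \<in> Q" using elts x(2)[OF h] by blast
  qed
  have inj: "inj_on (\<lambda>h. x \<otimes> h \<otimes> inv x) P"
    using x by (intro inj_onI) simp
  have finQ: "finite Q" using fin subgroup.subset[OF Q] finite_subset by blast
  have "card Q dvd Coset.order G" using lagrange[OF Q] by (metis dvd_triv_right)
  then have "k \<le> multiplicity p (Coset.order G)"
    using ordpos p cQ by (intro multiplicity_geI) (auto dest: prime_gt_1_nat)
  then have "card Q \<le> card P" unfolding cP cQ using p by (intro power_increasing prime_ge_1_nat) auto
  then have eq: "(\<lambda>h. x \<otimes> h \<otimes> inv x) ` P = Q"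
    using sub finQ inj by (intro card_subset_eq) (auto simp: card_image card_mono intro!: antisym dest: card_mono[OF finQ])
  have "(\<lambda>h. inv x \<otimes> h \<otimes> x) ` Q = (\<lambda>h. inv x \<otimes> (x \<otimes> h \<otimes> inv x) \<otimes> x) ` P"
    unfolding eq[symmetric] by (simp add: image_image)
  also have "\<dots> = P"
  proof -
    have "inv x \<otimes> (x \<otimes> h \<otimes> inv x) \<otimes> x = h" if "h \<in> P" for h
    proof -
      have "h \<in> carrier G" using that by simp
      then show ?thesis using x conjugation_is_surj[of "inv x" h] by simp
    qed
    then show ?thesis by simp
  qed
  finally show thesis using that x by blast
qed

text \<open>The Sylow theorem with exponent 1 acts as Cauchy's theorem: a prime divisor
  \<open>q\<close> of the order gives a nontrivial element whose order divides both \<open>q\<close>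
  and \<open>p ^ n\<close>, hence \<open>q = p\<close>. This replaces a count of the unitriangular
  group.\<close>

lemma (in group) card_eq_prime_power:
  assumes fin: "finite (carrier G)" and p: "Factorial_Ring.prime (p::nat)"
    and elts: "\<And>x. x \<in> carrier G \<Longrightarrow> x [^] (p ^ n) = \<one>"
  shows "\<exists>k. card (carrier G) = p ^ k"
proof -
  have "card (carrier G) \<noteq> 0" using fin one_closed by auto
  moreover have "q = p" if q: "Factorial_Ring.prime (q::nat)" "q dvd card (carrier G)" for q
  proof -
    obtain m where "Coset.order G = q ^ 1 * m" using q(2) by (auto simp: Coset.order_def dvd_def)
    then obtain H where H: "subgroup H G" "card H = q"
      using sylow_thm[OF q(1) is_group _ fin] by fastforce
    interpret H: subgroup H G by fact
    interpret GH: group "G\<lparr>carrier := H\<rparr>" using H(1) by (rule subgroup_imp_group)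
    have "\<not> H \<subseteq> {\<one>}"
    proof
      assume "H \<subseteq> {\<one>}"
      then have "card H \<le> 1" using card_mono[of "{\<one>}" H] by simp
      then show False using H(2) prime_gt_1_nat[OF q(1)] by simp
    qed
    then obtain h where h: "h \<in> H" "h \<noteq> \<one>" by blast
    have "h [^] q = \<one>"
      using GH.pow_order_eq_1[of h] h H(2) nat_pow_consistent[of h q H] by (simp add: Coset.order_def)
    moreover have "h [^] (p ^ n) = \<one>" using elts h by simp
    ultimately have "ord h dvd q" "ord h dvd p ^ n" "ord h \<noteq> 1"
      using h ord_eq_1 by (auto simp: pow_eq_id)
    then have "q dvd p ^ n" using q(1) by (metis prime_nat_iff)
    then show ?thesis using p q(1) by (metis prime_dvd_power primes_dvd_imp_eq)
  qed
  ultimately have "card (carrier G) = p ^ multiplicity p (card (carrier G))"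
  proof -
    assume nz: "card (carrier G) \<noteq> 0" and q: "\<And>q. Factorial_Ring.prime q \<Longrightarrow> q dvd card (carrier G) \<Longrightarrow> q = p"
    obtain r where r: "card (carrier G) = p ^ multiplicity p (card (carrier G)) * r" "\<not> p dvd r"
      using multiplicity_decompose'[of "card (carrier G)" p] nz p by (metis not_prime_unit)
    have "r = 1"
    proof (rule ccontr)
      assume "r \<noteq> 1"
      then obtain q' where "Factorial_Ring.prime q'" "q' dvd r" using prime_factor_nat by blast
      then show False using q[of q'] r by (metis dvd_mult)
    qed
    then show ?thesis using r by simp
  qed
  then show ?thesis by blast
qed

section \<open>Powers of nilpotent matrices\<close>

lemma index_mult_mat_sum:
  assumes "A \<in> carrier_mat n m" "B \<in> carrier_mat m l" "i < n" "j < l"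
  shows "(A * B) $$ (i, j) = (\<Sum>k<m. A $$ (i, k) * B $$ (k, j))"
  using assms by (auto simp: scalar_prod_def row_def col_def lessThan_atLeast0 intro!: sum.cong)

lemma pow_mat_Suc_left:
  assumes "(A :: 'a :: semiring_1 mat) \<in> carrier_mat n n"
  shows "A ^\<^sub>m Suc k = A * A ^\<^sub>m k"
proof (induction k)
  case 0
  then show ?case using assms by simp
next
  case (Suc k)
  have "A ^\<^sub>m Suc (Suc k) = (A * A ^\<^sub>m k) * A"
    using Suc.IH by simp
  also have "\<dots> = A * (A ^\<^sub>m k * A)"
    using assms by (intro assoc_mult_mat[of _ n n _ n _ n]) auto
  finally show ?case by simp
qed

lemma pow_mat_add:
  assumes "(A :: 'a :: semiring_1 mat) \<in> carrier_mat n n"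
  shows "A ^\<^sub>m (k + l) = A ^\<^sub>m k * A ^\<^sub>m l"
proof (induction l)
  case (Suc l)
  show ?case using assms Suc.IH
    by (simp add: assoc_mult_mat[of _ n n _ n _ n] mult_carrier_mat[of _ n n _ n])
qed (use assms in simp)

lemma pow_mat_mult:
  assumes "(A :: 'a :: semiring_1 mat) \<in> carrier_mat n n"
  shows "A ^\<^sub>m (k * l) = (A ^\<^sub>m k) ^\<^sub>m l"
  by (induction l) (use assms in \<open>auto simp: pow_mat_add[OF assms] simp flip: pow_mat_Suc_left[OF pow_carrier_mat[OF assms]]\<close>)

lemma similar_pow_mat:
  assumes "P \<in> carrier_mat n n" "R \<in> carrier_mat n n" "(D :: 'a :: semiring_1 mat) \<in> carrier_mat n n"
    and RP: "R * P = 1\<^sub>m n" and PR: "P * R = 1\<^sub>m n"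
  shows "(P * D * R) ^\<^sub>m k = P * D ^\<^sub>m k * R"
proof (induction k)
  case 0
  then show ?case using assms by simp
next
  case (Suc k)
  have c: "D ^\<^sub>m k \<in> carrier_mat n n" using assms by simp
  have "(P * D ^\<^sub>m k * R) * (P * D * R) = P * D ^\<^sub>m k * (R * P) * D * R"
    using assms(1-3) c by (simp add: assoc_mult_mat[of _ n n _ n _ n] mult_carrier_mat[of _ n n _ n])
  also have "\<dots> = P * (D ^\<^sub>m k * D) * R"
    using assms(1-3) c by (simp add: RP mult_carrier_mat[of _ n n _ n] assoc_mult_mat[of _ n n _ n _ n])
  finally show ?case using Suc.IH by simp
qed

text \<open>The binomial theorem applies because the identity commutes with \<open>N\<close>. The
  entrywise form makes the binomial coefficients scalars of the ring, where they can be reduced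
  modulo 5.\<close>

lemma pow_one_plus_mat_index:
  assumes N: "(N :: 'a :: comm_ring_1 mat) \<in> carrier_mat n n" and ij: "i < n" "j < n"
  shows "((1\<^sub>m n + N) ^\<^sub>m m) $$ (i, j) = (\<Sum>l\<le>m. of_nat (m choose l) * (N ^\<^sub>m l) $$ (i, j))"
  using ij
proof (induction m arbitrary: i j)
  case (Suc m)
  have C: "1\<^sub>m n + N \<in> carrier_mat n n" using N by simp
  have c: "(1\<^sub>m n + N) ^\<^sub>m m \<in> carrier_mat n n" using C by simp
  let ?b = "\<lambda>m l. of_nat (m choose l) * (N ^\<^sub>m l) $$ (i, j)"
  have "(1\<^sub>m n + N) ^\<^sub>m Suc m = (1\<^sub>m n + N) ^\<^sub>m m + (1\<^sub>m n + N) ^\<^sub>m m * N"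
    using N c by (simp add: mult_add_distrib_mat[of _ n n _ n])
  then have "((1\<^sub>m n + N) ^\<^sub>m Suc m) $$ (i, j)
      = ((1\<^sub>m n + N) ^\<^sub>m m) $$ (i, j) + (\<Sum>k<n. ((1\<^sub>m n + N) ^\<^sub>m m) $$ (i, k) * N $$ (k, j))"
    using N c Suc.prems by (simp del: index_mult_mat(1) add: index_mult_mat_sum[of _ n n _ n])
  also have "(\<Sum>k<n. ((1\<^sub>m n + N) ^\<^sub>m m) $$ (i, k) * N $$ (k, j))
      = (\<Sum>k<n. \<Sum>l\<le>m. of_nat (m choose l) * ((N ^\<^sub>m l) $$ (i, k) * N $$ (k, j)))"
    using Suc.prems Suc.IH by (intro sum.cong) (auto simp: sum_distrib_right mult.assoc)
  also have "\<dots> = (\<Sum>l\<le>m. of_nat (m choose l) * (\<Sum>k<n. (N ^\<^sub>m l) $$ (i, k) * N $$ (k, j)))"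
    by (subst sum.swap) (simp add: sum_distrib_left)
  also have "\<dots> = (\<Sum>l\<le>m. of_nat (m choose l) * (N ^\<^sub>m Suc l) $$ (i, j))"
    using N Suc.prems by (intro sum.cong) (auto simp del: index_mult_mat(1) simp add: index_mult_mat_sum[of _ n n _ n])
  also have "((1\<^sub>m n + N) ^\<^sub>m m) $$ (i, j) = ?b m 0 + (\<Sum>l\<le>m. of_nat (m choose Suc l) * (N ^\<^sub>m Suc l) $$ (i, j))"
  proof -
    have "((1\<^sub>m n + N) ^\<^sub>m m) $$ (i, j) = (\<Sum>l\<le>m. ?b m l)" by (rule Suc.IH) (use Suc.prems in auto)
    also have "\<dots> = (\<Sum>l\<le>Suc m. ?b m l)" by (simp add: binomial_eq_0)
    also have "\<dots> = ?b m 0 + (\<Sum>l\<le>m. ?b m (Suc l))" by (rule sum.atMost_Suc_shift)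
    finally show ?thesis .
  qed
  also have "?b m 0 + (\<Sum>l\<le>m. of_nat (m choose Suc l) * (N ^\<^sub>m Suc l) $$ (i, j))
      + (\<Sum>l\<le>m. of_nat (m choose l) * (N ^\<^sub>m Suc l) $$ (i, j)) = ?b (Suc m) 0 + (\<Sum>l\<le>m. ?b (Suc m) (Suc l))"
    by (simp add: sum.distrib algebra_simps)
  also have "\<dots> = (\<Sum>l\<le>Suc m. ?b (Suc m) l)" by (rule sum.atMost_Suc_shift[symmetric])
  finally show ?case .
qed (use N in simp)

text \<open>The inner binomial coefficients are 5 and 10. The identity turns fifth roots of a
  unipotent matrix into fifth roots of its nilpotent part.\<close>

lemma frobenius_mat:
  assumes N: "(N :: 'a :: comm_ring_1 mat) \<in> carrier_mat n n" and five: "(5 :: 'a) = 0"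
  shows "(1\<^sub>m n + N) ^\<^sub>m 5 = 1\<^sub>m n + N ^\<^sub>m 5"
proof (rule eq_matI)
  fix i j assume "i < dim_row (1\<^sub>m n + N ^\<^sub>m 5)" "j < dim_col (1\<^sub>m n + N ^\<^sub>m 5)"
  then have ij: "i < n" "j < n" using N by auto
  have "(10 :: 'a) = 5 * 2" by simp
  then have ten: "(10 :: 'a) = 0" using five by simp
  have c: "(5 choose 2) = (10::nat)" "(5 choose 3) = (10::nat)" "(5 choose 4) = (5::nat)" 
    by (simp_all add: numeral_eq_Suc)
  have "{..5} = {0,1,2,3,4,5::nat}" by auto
  then show "((1\<^sub>m n + N) ^\<^sub>m 5) $$ (i, j) = (1\<^sub>m n + N ^\<^sub>m 5) $$ (i, j)"
    using N ij by (simp add: pow_one_plus_mat_index c five ten)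
qed (use N in auto)

text \<open>Each factor \<open>N\<close> moves the position by at least 1, so
  \<open>N ^\<^sub>m k\<close> vanishes before the k-th superdiagonal, and on it only the path with
  all steps equal to 1 survives. The order \<open>p\<close> of the basis is a parameter because both
  the flag order and the reversed order occur.\<close>

lemma strict_upper_pow:
  assumes N: "(N :: 'a :: comm_ring_1 mat) \<in> carrier_mat n n" and p: "bij_betw p {..<n} {..<n}"
    and up: "\<And>i j. i < n \<Longrightarrow> j \<le> i \<Longrightarrow> N $$ (p i, p j) = 0"
    and i: "i < n" and j: "j < n"
  shows "j < i + k \<Longrightarrow> (N ^\<^sub>m k) $$ (p i, p j) = 0"
    and "j = i + k \<Longrightarrow> (N ^\<^sub>m k) $$ (p i, p j) = (\<Prod>t<k. N $$ (p (i + t), p (Suc (i + t))))"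
proof -
  have pn: "p i < n" if "i < n" for i using p that by (auto simp: bij_betw_def)
  have inj: "p i = p j \<longleftrightarrow> i = j" if "i < n" "j < n" for i j
    using p that by (auto simp: bij_betw_def inj_on_def)
  have step: "(N ^\<^sub>m Suc k) $$ (p i, p j) = (\<Sum>l<n. (N ^\<^sub>m k) $$ (p i, p l) * N $$ (p l, p j))"
    if "i < n" "j < n" for k i j
    using that N pn
    by (simp del: index_mult_mat(1) add: index_mult_mat_sum[of _ n n _ n] sum.reindex_bij_betw[OF p, where g = "\<lambda>l. (N ^\<^sub>m k) $$ (p i, l) * N $$ (l, p j)", symmetric])
  have zero: "(N ^\<^sub>m k) $$ (p i, p j) = 0" if "i < n" "j < n" "j < i + k" for k i j
    using that
  proof (induction k arbitrary: j)
    case 0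
    then show ?case using N pn inj by simp
  next
    case (Suc k)
    have "(N ^\<^sub>m k) $$ (p i, p l) * N $$ (p l, p j) = 0" if "l < n" for l
      using Suc up[of l j] that by (cases "j \<le> l") auto
    then show ?case using Suc.prems by (simp add: step del: pow_mat.simps)
  qed
  then show "(N ^\<^sub>m k) $$ (p i, p j) = 0" if "j < i + k"
    using i j that by simp
  show "(N ^\<^sub>m k) $$ (p i, p j) = (\<Prod>t<k. N $$ (p (i + t), p (Suc (i + t))))" if "j = i + k"
    using j that
  proof (induction k arbitrary: j)
    case 0
    then show ?case using N pn i by simp
  next
    case (Suc k)
    have "(N ^\<^sub>m k) $$ (p i, p l) * N $$ (p l, p j) = 0" if "l < n" "l \<noteq> i + k" for l
      using Suc.prems up[of l j] zero[of i l k] i that by (cases "j \<le> l") auto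
    then have "(N ^\<^sub>m Suc k) $$ (p i, p j) = (\<Sum>l\<in>{i + k}. (N ^\<^sub>m k) $$ (p i, p l) * N $$ (p l, p j))"
      unfolding step[OF i Suc.prems(1)] using Suc.prems by (intro sum.mono_neutral_right) auto
    then show ?case using Suc.IH[of "i + k"] Suc.prems by simp
  qed
qed

section \<open>Traces, the nilpotent Jordan block and cyclic bases\<close>

definition mat_tr :: "'a :: comm_ring_1 mat \<Rightarrow> 'a" where
  "mat_tr A = (\<Sum>i<dim_row A. A $$ (i, i))"

lemma mat_tr_comm:
  assumes "A \<in> carrier_mat n m" "B \<in> carrier_mat m n"
  shows "mat_tr (A * B) = mat_tr (B * A)"
proof -
  have "mat_tr (A * B) = (\<Sum>i<n. \<Sum>k<m. A $$ (i, k) * B $$ (k, i))"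
    unfolding mat_tr_def using assms by (intro sum.cong) (auto simp: index_mult_mat_sum[of _ n m _ n] simp del: index_mult_mat(1))
  also have "\<dots> = (\<Sum>k<m. \<Sum>i<n. B $$ (k, i) * A $$ (i, k))"
    by (subst sum.swap) (simp add: mult.commute)
  also have "\<dots> = mat_tr (B * A)"
    unfolding mat_tr_def using assms by (intro sum.cong) (auto simp: index_mult_mat_sum[of _ m n _ m] simp del: index_mult_mat(1))
  finally show ?thesis .
qed

definition shift_mat :: "nat \<Rightarrow> 'a :: comm_ring_1 mat" where
  "shift_mat n = mat n n (\<lambda>(i, j). if i = Suc j then 1 else 0)"

lemma shift_mat_carrier [simp]: "shift_mat n \<in> carrier_mat n n"
  by (simp add: shift_mat_def)

lemma shift_mat_dim [simp]: "dim_row (shift_mat n) = n" "dim_col (shift_mat n) = n"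
  by (simp_all add: shift_mat_def)

lemma mult_shift_mat_index:
  assumes "A \<in> carrier_mat m n" "i < m" "j < n"
  shows "(A * shift_mat n) $$ (i, j) = (if Suc j < n then A $$ (i, Suc j) else 0)"
proof -
  have "(A * shift_mat n) $$ (i, j) = (\<Sum>k<n. if k = Suc j then A $$ (i, k) else 0)"
    using assms by (simp del: index_mult_mat(1) add: index_mult_mat_sum[of _ m n _ n] shift_mat_def if_distrib cong: if_cong)
  then show ?thesis by simp
qed

lemma shift_mat_mult_index:
  assumes "A \<in> carrier_mat n m" "i < n" "j < m"
  shows "(shift_mat n * A) $$ (i, j) = (if i > 0 then A $$ (i - 1, j) else 0)"
proof -
  have "(shift_mat n * A) $$ (i, j) = (\<Sum>k<n. if i = Suc k then A $$ (k, j) else 0)"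
    using assms by (simp del: index_mult_mat(1) add: index_mult_mat_sum[of _ n n _ m] shift_mat_def if_distrib if_distribR cong: if_cong)
  also have "\<dots> = (if i > 0 then A $$ (i - 1, j) else 0)"
    using assms by (cases i) (auto simp: sum.delta')
  finally show ?thesis .
qed

lemma shift_mat_pow_index:
  assumes "i < n" "j < n"
  shows "(shift_mat n ^\<^sub>m k) $$ (i, j) = (if i = j + k then 1 else 0)"
  using assms
proof (induction k arbitrary: j)
  case (Suc k)
  then show ?case by (auto simp: mult_shift_mat_index[of _ n n] simp del: index_mult_mat(1))
qed (auto simp: shift_mat_def)

definition krylov_mat :: "nat \<Rightarrow> 'a :: comm_ring_1 mat \<Rightarrow> nat \<Rightarrow> 'a mat" where
  "krylov_mat n N q = mat n n (\<lambda>(i, j). (N ^\<^sub>m j) $$ (i, q))"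

lemma krylov_mat_carrier [simp]: "krylov_mat n N q \<in> carrier_mat n n"
  by (simp add: krylov_mat_def)

text \<open>\<open>N\<close> moves each column of the Krylov matrix to the next one. The last column
  has no successor; there \<open>nil\<close> matches the zero column of the shift matrix.\<close>

lemma mult_krylov_mat:
  assumes N: "(N :: 'a :: comm_ring_1 mat) \<in> carrier_mat n n" and q: "q < n" and nil: "N ^\<^sub>m n = 0\<^sub>m n n"
  shows "N * krylov_mat n N q = krylov_mat n N q * shift_mat n"
proof (rule eq_matI)
  fix i j assume "i < dim_row (krylov_mat n N q * shift_mat n)" "j < dim_col (krylov_mat n N q * shift_mat n)"
  then have ij: "i < n" "j < n" by (auto simp: krylov_mat_def shift_mat_def)
  have "(N * krylov_mat n N q) $$ (i, j) = (\<Sum>k<n. N $$ (i, k) * (N ^\<^sub>m j) $$ (k, q))"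
    using N ij by (simp del: index_mult_mat(1) add: index_mult_mat_sum[of _ n n _ n]) (simp add: krylov_mat_def)
  also have "\<dots> = (N * N ^\<^sub>m j) $$ (i, q)" using N ij q by (simp del: index_mult_mat(1) add: index_mult_mat_sum[of _ n n _ n])
  also have "\<dots> = (N ^\<^sub>m Suc j) $$ (i, q)" using N by (simp add: pow_mat_Suc_left del: pow_mat.simps)
  also have "\<dots> = (krylov_mat n N q * shift_mat n) $$ (i, j)"
  proof (cases "Suc j < n")
    case False
    then have "Suc j = n" using ij by simp
    then show ?thesis using ij q nil by (simp add: mult_shift_mat_index[of _ n n])
  qed (use ij in \<open>simp add: mult_shift_mat_index[of _ n n] krylov_mat_def del: index_mult_mat(1)\<close>)
  finally show "(N * krylov_mat n N q) $$ (i, j) = (krylov_mat n N q * shift_mat n) $$ (i, j)" .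
qed (use N in \<open>auto simp: krylov_mat_def shift_mat_def\<close>)

lemma mat_inverse_exists:
  assumes "(P :: 'a :: field mat) \<in> carrier_mat n n" "\<And>v. v \<in> carrier_vec n \<Longrightarrow> P *\<^sub>v v = 0\<^sub>v n \<Longrightarrow> v = 0\<^sub>v n"
  obtains R where "R \<in> carrier_mat n n" "P * R = 1\<^sub>m n" "R * P = 1\<^sub>m n"
proof -
  have "det P \<noteq> 0" using assms by (subst det_0_iff_vec_prod_zero_field) auto
  from det_non_zero_imp_unit[OF assms(1) this] obtain R where
    "R \<in> carrier_mat n n" "R * P = 1\<^sub>m n" "P * R = 1\<^sub>m n"
    by (auto simp: Units_def ring_mat_simps)
  then show thesis using that by blast
qed

lemma finite_carrier_mat:
  "finite (UNIV :: 'a set) \<Longrightarrow> finite (carrier_mat n m :: 'a mat set)"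
proof -
  assume fin: "finite (UNIV :: 'a set)"
  have "carrier_mat n m \<subseteq> (\<lambda>xs. mat n m (\<lambda>(i, j). xs ! (i * m + j))) ` {xs :: 'a list. set xs \<subseteq> UNIV \<and> length xs = n * m}"
  proof
    fix A :: "'a mat" assume A: "A \<in> carrier_mat n m"
    let ?xs = "map (\<lambda>k. A $$ (k div m, k mod m)) [0..<n * m]"
    have "A = mat n m (\<lambda>(i, j). ?xs ! (i * m + j))"
    proof (rule eq_matI)
      fix i j assume "i < dim_row (mat n m (\<lambda>(i, j). ?xs ! (i * m + j)))" "j < dim_col (mat n m (\<lambda>(i, j). ?xs ! (i * m + j)))"
      then have ij: "i < n" "j < m" by auto
      have "i * m + j < Suc i * m" using ij by simp
      also have "\<dots> \<le> n * m" using ij by (intro mult_le_mono1) simp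
      finally show "A $$ (i, j) = mat n m (\<lambda>(i, j). ?xs ! (i * m + j)) $$ (i, j)" using ij by simp
    qed (use A in auto)
    then show "A \<in> (\<lambda>xs. mat n m (\<lambda>(i, j). xs ! (i * m + j))) ` {xs :: 'a list. set xs \<subseteq> UNIV \<and> length xs = n * m}"
      by (intro image_eqI[of _ _ ?xs]) auto
  qed
  then show ?thesis using finite_lists_length_eq[OF fin, of "n * m"] finite_subset by blast
qed

section \<open>The field with five elements and the matrices of the example\<close>

lemma sum_lessThan_6: "(\<Sum>k<6. f k) = f 0 + f 1 + f 2 + f 3 + f 4 + f (5::nat)"
  by (simp add: eval_nat_numeral)

lemma less_6_cases: "(i::nat) < 6 \<Longrightarrow> i = 0 \<or> i = 1 \<or> i = 2 \<or> i = 3 \<or> i = 4 \<or> i = 5"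
  by auto

locale card_5_field =
  fixes ty :: "'a :: field itself"
  assumes card_5: "CARD('a) = 5"
begin

lemma finite_field: "finite (UNIV :: 'a set)"
  using card_5 by (metis card.infinite zero_neq_numeral)

text \<open>Translation by 1 permutes the field and adds 5 to the sum of its elements.\<close>

lemma five_eq_0: "(5 :: 'a) = 0"
proof -
  have "(\<Sum>x\<in>UNIV. x :: 'a) = (\<Sum>x\<in>UNIV. x + 1)"
    by (rule sum.reindex_bij_betw[symmetric]) (auto intro!: bij_betwI[of _ _ _ "\<lambda>x. x - 1"])
  also have "\<dots> = (\<Sum>x\<in>UNIV. x) + 5" using card_5 by (simp add: sum.distrib)
  finally show ?thesis by simp
qed

lemma two_neq_0: "(2 :: 'a) \<noteq> 0"
proof
  assume "(2 :: 'a) = 0"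
  moreover have "(5 :: 'a) = 2 * 2 + 1" by simp
  ultimately show False using five_eq_0 by simp
qed

text \<open>Multiplication by a nonzero \<open>x\<close> permutes the four nonzero elements, whose
  product can be cancelled.\<close>

lemma power_5: "(x :: 'a) ^ 5 = x"
proof (cases "x = 0")
  case False
  let ?U = "UNIV - {0 :: 'a}"
  have "(\<Prod>y\<in>?U. x * y) = (\<Prod>y\<in>?U. y)"
    by (rule prod.reindex_bij_betw) (use False in \<open>auto intro!: bij_betwI[of _ _ _ "\<lambda>y. y / x"]\<close>)
  moreover have "(\<Prod>y\<in>?U. x * y) = x ^ card ?U * (\<Prod>y\<in>?U. y)" by (simp add: prod.distrib)
  moreover have "(\<Prod>y\<in>?U. y) \<noteq> 0" using finite_field by simp
  moreover have "card ?U = 4" using card_5 finite_field by (simp add: card_Diff_singleton)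
  ultimately have "x ^ 4 = 1" by simp
  then show ?thesis by (simp add: eval_nat_numeral)
qed simp

text \<open>Consequently 1 is the only field element of 5-power order; applied to diagonal entries,
  this recognises the elements of 5-power order in the Borel subgroup.\<close>

lemma power_power_5: "(x :: 'a) ^ (5 ^ k) = x"
  by (induction k) (simp_all add: power_mult mult.commute[of 5] power_5)

lemma square_cases: "(x :: 'a) = 0 \<or> x\<^sup>2 = 1 \<or> x\<^sup>2 = - 1"
proof -
  have "x * (x\<^sup>2 - 1) * (x\<^sup>2 + 1) = 0"
    using power_5[of x] by (simp add: algebra_simps eval_nat_numeral)
  then show ?thesis by (simp add: eq_neg_iff_add_eq_0)
qed

text \<open>This is where the two classes of transvections are told apart: \<open>1 - 2 * 2 * x\<^sup>2\<close> is \<open>0\<close> or the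
  nonsquare \<open>2\<close>.\<close>

lemma square_product_eq_1:
  assumes "(1 + y)\<^sup>2 * (1 - 2 * 2 * x\<^sup>2) = (1 :: 'a)"
  shows "x = 0"
proof (rule ccontr)
  assume "x \<noteq> 0"
  then consider "x\<^sup>2 = 1" | "x\<^sup>2 = - 1" using square_cases[of x] by fastforce
  then show False
  proof cases
    case 1
    have four: "(4 :: 'a) \<noteq> 0" using two_neq_0 mult_eq_0_iff[of "2 :: 'a" 2] by simp
    \<comment> \<open>The second factor is -3, which is 2 modulo 5, while the square can only be 0,
      1 or -1; each choice contradicts characteristic 5.\<close>
    have *: "(1 + y)\<^sup>2 * (- 3) = 1" using assms unfolding 1 by simp
    consider "(1 + y)\<^sup>2 = 0" | "(1 + y)\<^sup>2 = 1" | "(1 + y)\<^sup>2 = - 1"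
      using square_cases[of "1 + y"] by fastforce
    then show False
    proof cases
      case 2
      have "(4 :: 'a) = 1 - (- 3)" by simp
      also have "- 3 = (1 :: 'a)" using * unfolding 2 by simp
      finally show False using four by simp
    next
      case 3
      have "(2 :: 'a) = 3 - 1" by simp
      also have "3 = (1 :: 'a)" using * unfolding 3 by simp
      finally show False using two_neq_0 by simp
    qed (use * in simp)
  next
    case 2
    have "1 - 2 * 2 * x\<^sup>2 = (5 :: 'a)" unfolding 2 by simp
    then show False using assms five_eq_0 by simp
  qed
qed

end

section \<open>The transvection, the element \<open>u\<close> and the symplectic form\<close>

definition corner_mat :: "'a :: comm_ring_1 \<Rightarrow> 'a mat" where
  "corner_mat c = mat 6 6 (\<lambda>(i, j). if i = 0 \<and> j = 3 then c else 0)"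

lemma corner_mat_carrier [simp]: "corner_mat c \<in> carrier_mat 6 6"
  by (simp add: corner_mat_def)

lemma corner_mat_dim [simp]: "dim_row (corner_mat c) = 6" "dim_col (corner_mat c) = 6"
  by (simp_all add: corner_mat_def)

lemma mult_corner_mat_index:
  assumes "A \<in> carrier_mat 6 6" "i < 6" "j < 6"
  shows "(A * corner_mat c) $$ (i, j) = (if j = 3 then A $$ (i, 0) * c else 0)"
    and "(corner_mat c * A) $$ (i, j) = (if i = 0 then c * A $$ (3, j) else 0)"
  using assms
  by (auto simp del: index_mult_mat(1) simp add: index_mult_mat_sum[of _ 6 6 _ 6] sum_lessThan_6)
     (auto simp: corner_mat_def)

text \<open>An element of the symplectic Lie algebra with square zero, so that \<open>1 + L\<close>
  and \<open>1 - L\<close> are mutually inverse symplectic matrices. The entries (0, 1) and (4, 3)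
  together form a short root vector, hence the opposite signs; the entry (2, 5) is a long root
  vector, and its value 2 reappears in the factor 1 - 2 c x^2.\<close>

definition log_mat :: "'a :: comm_ring_1 mat" where
  "log_mat = mat 6 6 (\<lambda>(i, j). if i = 0 \<and> j = 1 then 1 else if i = 4 \<and> j = 3 then - 1
     else if i = 2 \<and> j = 5 then 2 else 0)"

lemma log_mat_carrier [simp]: "log_mat \<in> carrier_mat 6 6"
  by (simp add: log_mat_def)

lemma log_mat_dim [simp]: "dim_row log_mat = 6" "dim_col log_mat = 6"
  by (simp_all add: log_mat_def)

lemma mult_log_mat_index:
  assumes "A \<in> carrier_mat 6 6" "i < 6" "j < 6"
  shows "(A * log_mat) $$ (i, j) = (if j = 1 then A $$ (i, 0) else if j = 3 then - A $$ (i, 4)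
     else if j = 5 then 2 * A $$ (i, 2) else 0)"
  using assms
  by (auto simp del: index_mult_mat(1) simp add: index_mult_mat_sum[of _ 6 6 _ 6] sum_lessThan_6)
     (auto simp: log_mat_def)

lemma mult_log_mat_mult_index:
  assumes "A \<in> carrier_mat 6 6" "B \<in> carrier_mat 6 6" "i < 6" "j < 6"
  shows "(A * log_mat * B) $$ (i, j) = A $$ (i, 0) * B $$ (1, j) - A $$ (i, 4) * B $$ (3, j)
     + 2 * A $$ (i, 2) * B $$ (5, j)"
  using assms mult_carrier_mat[OF assms(1) log_mat_carrier]
  by (simp del: index_mult_mat(1) add: index_mult_mat_sum[of "A * log_mat" 6 6 _ 6] sum_lessThan_6 mult_log_mat_index)

lemma sp_form_3_index:
  "i < 6 \<Longrightarrow> j < 6 \<Longrightarrow> sp_form 3 $$ (i, j)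
     = (if j = i + 3 then 1 else if i = j + 3 then - 1 else 0 :: 'a :: comm_ring_1)"
  by (auto simp: sp_form_def)

lemma sp_form_3_carrier [simp]: "sp_form 3 \<in> carrier_mat 6 6"
  using sp_form_carrier[of 3] by simp

lemma carrier_Sp_3: "carrier (Sp 3) = {A \<in> carrier_mat 6 6. transpose_mat A * sp_form 3 * A = sp_form 3}"
  by (simp add: Sp_def)

section \<open>Fifth roots of a transvection\<close>

text \<open>The assumptions concern a single root and do not mention u, so the locale applies to
  \<open>A\<close> and to A u^-1 alike.\<close>

locale transvection_root = card_5_field ty for ty :: "'a :: field itself" +
  fixes A :: "'a mat" and c :: 'a
  assumes A: "A \<in> carrier_mat 6 6" and A_sp: "transpose_mat A * sp_form 3 * A = sp_form 3"
    and A_pow: "A ^\<^sub>m 5 = 1\<^sub>m 6 + corner_mat c" and c: "c \<noteq> 0"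
begin

definition N :: "'a mat" where "N = A - 1\<^sub>m 6"

lemma N: "N \<in> carrier_mat 6 6"
  by (simp add: N_def minus_carrier_mat)

lemma A_eq: "A = 1\<^sub>m 6 + N"
  using A by (auto simp: N_def)

lemma N_pow_5: "N ^\<^sub>m 5 = corner_mat c"
proof -
  have "1\<^sub>m 6 + N ^\<^sub>m 5 = 1\<^sub>m 6 + corner_mat c"
    using frobenius_mat[OF N five_eq_0] A_pow A_eq by simp
  then have "N ^\<^sub>m 5 + 1\<^sub>m 6 = corner_mat c + 1\<^sub>m 6"
    using N by (simp add: comm_add_mat[of _ 6 6])
  then have "N ^\<^sub>m 5 + 1\<^sub>m 6 - 1\<^sub>m 6 = corner_mat c + 1\<^sub>m 6 - 1\<^sub>m 6" by simp
  moreover have "B + 1\<^sub>m 6 - 1\<^sub>m 6 = B" if "B \<in> carrier_mat 6 6" for B :: "'a mat"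
    using that by auto
  ultimately show ?thesis using N by simp
qed

lemma N_corner: "N * corner_mat c = corner_mat c * N"
  using pow_mat_Suc_left[OF N, of 5] unfolding pow_mat.simps N_pow_5 by (rule sym)

text \<open>Commuting with its own power \<open>corner_mat c\<close>, the matrix \<open>N\<close>
  preserves the image of that power, which is the line of e_0, and its kernel, which is the
  hyperplane where coordinate 3 vanishes. The two scalars that remain, at (0, 0) and (3, 3), agree,
  and their fifth power is the entry (0, 0) of \<open>corner_mat c\<close>, which is 0.\<close>

lemma N_index_0: "i < 6 \<Longrightarrow> N $$ (i, 0) = 0"
  and N_index_3: "j < 6 \<Longrightarrow> N $$ (3, j) = 0"
proof -
  have entry: "(if j = 3 then N $$ (i, 0) * c else 0) = (if i = 0 then c * N $$ (3, j) else 0)"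
    if "i < 6" "j < 6" for i j
    using mult_corner_mat_index[OF N that, of c] N_corner by simp
  have i0: "N $$ (i, 0) = 0" if "i < 6" "i \<noteq> 0" for i
    using entry[of i 3] that c by simp
  have j3: "N $$ (3, j) = 0" if "j < 6" "j \<noteq> 3" for j
    using entry[of 0 j] that c by simp
  have "N $$ (0, 0) = N $$ (3, 3)" using entry[of 0 3] c by simp
  moreover have "N $$ (0, 0) = 0"
  proof -
    have "(N ^\<^sub>m k) $$ (0, 0) = N $$ (0, 0) ^ k" for k
    proof (induction k)
      case (Suc k)
      then show ?case using N i0
        by (simp del: index_mult_mat(1) add: index_mult_mat_sum[of _ 6 6 _ 6] sum_lessThan_6)
    qed (use N in simp)
    from this[of 5] show ?thesis by (simp add: N_pow_5 corner_mat_def)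
  qed
  ultimately show "i < 6 \<Longrightarrow> N $$ (i, 0) = 0" "j < 6 \<Longrightarrow> N $$ (3, j) = 0"
    using i0 j3 by metis+
qed

lemma N_pow_6: "N ^\<^sub>m 6 = 0\<^sub>m 6 6"
proof -
  have "N ^\<^sub>m 6 = N * corner_mat c"
    using pow_mat_Suc_left[OF N, of 5] N_pow_5 by (simp add: numeral_eq_Suc)
  also have "\<dots> = 0\<^sub>m 6 6"
    by (rule eq_matI) (use N in \<open>auto simp: mult_corner_mat_index[OF N] N_index_0 simp del: index_mult_mat(1)\<close>)
  finally show ?thesis .
qed

definition P :: "'a mat" where "P = krylov_mat 6 N 3"

lemma P: "P \<in> carrier_mat 6 6"
  by (simp add: P_def)

lemma N_P: "N * P = P * shift_mat 6"
  unfolding P_def using N N_pow_6 by (intro mult_krylov_mat) auto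

lemma P_index_5: "i < 6 \<Longrightarrow> P $$ (i, 5) = (if i = 0 then c else 0)"
  by (simp add: P_def krylov_mat_def N_pow_5 corner_mat_def)

section \<open>The Gram matrix of the cyclic basis\<close>

definition G :: "'a mat" where "G = transpose_mat P * sp_form 3 * P"

lemma G: "G \<in> carrier_mat 6 6"
  using P by (simp add: G_def mult_carrier_mat[of _ 6 6 _ 6])

text \<open>\<open>G $$ (i, j)\<close> is the form evaluated at N^i e_3 and N^j e_3. Inserting A = 1
  + N into the invariance of the form leaves these three terms; the case distinctions express N^6 =
  0.\<close>

lemma G_invariant:
  assumes "i < 6" "j < 6"
  shows "(if Suc i < 6 then G $$ (Suc i, j) else 0) + (if Suc j < 6 then G $$ (i, Suc j) else 0)
    + (if Suc i < 6 \<and> Suc j < 6 then G $$ (Suc i, Suc j) else 0) = 0"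
proof -
  let ?S = "shift_mat 6 :: 'a mat" and ?J = "sp_form 3 :: 'a mat"
  have PS: "P + P * ?S \<in> carrier_mat 6 6" using P by (simp add: mult_carrier_mat[of _ 6 6 _ 6])
  have AP: "A * P = P + P * ?S"
    using N P by (subst A_eq) (simp add: add_mult_distrib_mat[of _ 6 6 _ _ 6] N_P)
  have "G = transpose_mat P * (transpose_mat A * ?J * A) * P" by (simp add: A_sp G_def)
  also have "\<dots> = transpose_mat (A * P) * ?J * (A * P)"
    using A P by (simp add: transpose_mult[of _ 6 6 _ 6] assoc_mult_mat[of _ 6 6 _ 6 _ 6] mult_carrier_mat[of _ 6 6 _ 6])
  also have "\<dots> = (transpose_mat P + transpose_mat ?S * transpose_mat P) * ?J * (P + P * ?S)"
    unfolding AP using P by (simp add: transpose_add[of _ 6 6] transpose_mult[of _ 6 6 _ 6] mult_carrier_mat[of _ 6 6 _ 6])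
  also have "\<dots> = (G + transpose_mat ?S * G) + (G + transpose_mat ?S * G) * ?S"
    using P unfolding G_def
    by (simp add: add_mult_distrib_mat[of _ 6 6 _ _ 6] mult_add_distrib_mat[of _ 6 6 _ 6] 
       assoc_mult_mat[of _ 6 6 _ 6 _ 6] mult_carrier_mat[of _ 6 6 _ 6] add_carrier_mat[of _ 6 6])
  finally have eq: "G = (G + transpose_mat ?S * G) + (G + transpose_mat ?S * G) * ?S" .
  have SG: "(transpose_mat ?S * G) $$ (i, j) = (if Suc i < 6 then G $$ (Suc i, j) else 0)" if "i < 6" "j < 6" for i j
  proof -
    have "transpose_mat ?S * G = transpose_mat (transpose_mat G * ?S)"
      using G by (simp add: transpose_mult[of _ 6 6 _ 6])
    then show ?thesis using G that mult_shift_mat_index[of "transpose_mat G" 6 6 j i]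
      by (simp del: index_mult_mat(1))
  qed
  have c1: "G + transpose_mat ?S * G \<in> carrier_mat 6 6" using G by (simp add: mult_carrier_mat[of _ 6 6 _ 6])
  have "G $$ (i, j) = ((G + transpose_mat ?S * G) + (G + transpose_mat ?S * G) * ?S) $$ (i, j)"
    using eq by simp
  also have "\<dots> = (G + transpose_mat ?S * G) $$ (i, j) + ((G + transpose_mat ?S * G) * ?S) $$ (i, j)"
    using assms c1 by (intro index_add_mat(1)) auto
  also have "\<dots> = G $$ (i, j) + (if Suc i < 6 then G $$ (Suc i, j) else 0)
    + (if Suc j < 6 then G $$ (i, Suc j) + (if Suc i < 6 then G $$ (Suc i, Suc j) else 0) else 0)"
    using assms c1 G
    by (simp del: index_mult_mat(1) add: mult_shift_mat_index[of _ 6 6] SG)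
  finally show ?thesis by (simp add: algebra_simps split: if_splits)
qed

lemma G_alternating:
  assumes "i < 6" "j < 6"
  shows "G $$ (j, i) = - G $$ (i, j)" "G $$ (i, i) = 0"
proof -
  have formula: "G $$ (i, j) = P $$ (0, i) * P $$ (3, j) + P $$ (1, i) * P $$ (4, j) + P $$ (2, i) * P $$ (5, j)
    - P $$ (3, i) * P $$ (0, j) - P $$ (4, i) * P $$ (1, j) - P $$ (5, i) * P $$ (2, j)" if "i < 6" "j < 6" for i j
    using that P unfolding G_def
    by (simp del: index_mult_mat(1) add: index_mult_mat_sum[of _ 6 6 _ 6] sum_lessThan_6 mult_carrier_mat[of _ 6 6 _ 6] sp_form_3_index)
  show "G $$ (j, i) = - G $$ (i, j)" "G $$ (i, i) = 0"
    unfolding formula[OF assms] formula[OF assms(2,1)] formula[OF assms(1,1)] by simp_all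
qed

text \<open>The last basis vector N^5 e_3 is c e_0, and the form takes the value -1 at e_3 and
  e_0.\<close>

lemma G_index_0_5: "G $$ (0, 5) = - c"
proof -
  have "P $$ (3, 0) = 1" using N by (simp add: P_def krylov_mat_def)
  then show ?thesis using P P_index_5 unfolding G_def
    by (simp del: index_mult_mat(1) add: index_mult_mat_sum[of _ 6 6 _ 6] sum_lessThan_6 mult_carrier_mat[of _ 6 6 _ 6] sp_form_3_index)
qed

text \<open>Invariance spreads the corner entry over the antidiagonal with alternating signs and
  forces zeros beyond it. The entry at (1, 2) stays open; where it occurs later it is multiplied by
  a coordinate of e_2 that turns out to be 0.\<close>

lemma G_index:
  "G $$ (Suc 0, 5) = 0" "G $$ (2, 5) = 0" "G $$ (3, 5) = 0" "G $$ (4, 5) = 0"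
  "G $$ (Suc 0, 4) = c" "G $$ (2, 4) = 0" "G $$ (3, 4) = 0" "G $$ (2, 3) = - c" "G $$ (Suc 0, 3) = c"
proof -
  show a: "G $$ (Suc 0, 5) = 0" "G $$ (2, 5) = 0" "G $$ (3, 5) = 0" "G $$ (4, 5) = 0"
    using G_invariant[of 0 5] G_invariant[of 1 5] G_invariant[of 2 5] G_invariant[of 3 5] by (simp_all add: numeral_eq_Suc)
  show b: "G $$ (Suc 0, 4) = c" 
    using G_invariant[of 0 4] a G_index_0_5 by (simp add: numeral_eq_Suc)
  show d: "G $$ (2, 4) = 0" "G $$ (3, 4) = 0"
    using G_invariant[of 1 4] G_invariant[of 2 4] a by (simp_all add: numeral_eq_Suc)
  show e: "G $$ (2, 3) = - c" 
    using G_invariant[of 1 3] b d by (simp add: eq_neg_iff_add_eq_0 numeral_eq_Suc)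
  show "G $$ (Suc 0, 3) = c" 
    using G_invariant[of 1 2] G_alternating[of 2 2] e by (simp add: numeral_eq_Suc)
qed

lemma G_index_lower:
  "G $$ (5, 0) = c" "G $$ (5, Suc 0) = 0" "G $$ (5, 2) = 0" "G $$ (5, 3) = 0" "G $$ (5, 4) = 0"
  "G $$ (4, Suc 0) = - c" "G $$ (4, 2) = 0" "G $$ (4, 3) = 0" "G $$ (3, 2) = c" "G $$ (3, Suc 0) = - c"
  "G $$ (2, Suc 0) = - G $$ (Suc 0, 2)"
  "G $$ (0, 0) = 0" "G $$ (Suc 0, Suc 0) = 0" "G $$ (2, 2) = 0" "G $$ (3, 3) = 0" "G $$ (4, 4) = 0" "G $$ (5, 5) = 0"
  using G_alternating[of 0 5] G_alternating[of 1 5] G_alternating[of 2 5] G_alternating[of 3 5] G_alternating[of 4 5]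
    G_alternating[of 1 4] G_alternating[of 2 4] G_alternating[of 3 4] G_alternating[of 2 3] G_alternating[of 1 3] 
    G_alternating[of 1 2] G_alternating(2)[of 5 5]
  by (simp_all add: G_index G_index_0_5)

text \<open>If \<open>P\<close> kills \<open>v\<close>, so does \<open>G\<close>. As
  \<open>G\<close> is zero beyond the antidiagonal and has entries c or -c on it, its rows, read
  from the last one upwards, force the entries of \<open>v\<close> to vanish one after the
  other.\<close>

lemma P_invertible: "\<exists>R. R \<in> carrier_mat 6 6 \<and> P * R = 1\<^sub>m 6 \<and> R * P = 1\<^sub>m 6"
proof (rule mat_inverse_exists[OF P])
  fix v :: "'a vec" assume v: "v \<in> carrier_vec 6" and Pv: "P *\<^sub>v v = 0\<^sub>v 6"
  have "G *\<^sub>v v = transpose_mat P * sp_form 3 *\<^sub>v (P *\<^sub>v v)"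
    using P v unfolding G_def by (intro assoc_mult_mat_vec[of _ 6 6 _ 6]) (auto simp: mult_carrier_mat[of _ 6 6 _ 6])
  also have "\<dots> = 0\<^sub>v 6"
    unfolding Pv using P by (intro eq_vecI) (auto simp: mult_carrier_mat[of _ 6 6 _ 6])
  finally have Gv: "G *\<^sub>v v = 0\<^sub>v 6" .
  have row: "(\<Sum>j<6. G $$ (i, j) * v $ j) = 0" if "i < 6" for i
  proof -
    have "(\<Sum>j<6. G $$ (i, j) * v $ j) = (G *\<^sub>v v) $ i"
      using that G v by (auto simp: scalar_prod_def lessThan_atLeast0 intro!: sum.cong)
    then show ?thesis using Gv that by simp
  qed
  have 0: "v $ 0 = 0" using row[of 5] c by (simp add: sum_lessThan_6 G_index_lower)
  have 1: "v $ Suc 0 = 0" using row[of 4] c 0 by (simp add: sum_lessThan_6 G_index_lower G_index)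
  have 2: "v $ 2 = 0" using row[of 3] c 0 1 by (simp add: sum_lessThan_6 G_index_lower G_index)
  have 3: "v $ 3 = 0" using row[of 2] c 0 1 2 by (simp add: sum_lessThan_6 G_index_lower G_index)
  have 4: "v $ 4 = 0" using row[of 1] c 0 1 2 3 by (simp add: sum_lessThan_6 G_index_lower G_index)
  have 5: "v $ 5 = 0" using row[of 0] c 0 1 2 3 4 by (simp add: sum_lessThan_6 G_index_lower G_index G_index_0_5)
  show "v = 0\<^sub>v 6"
    by (rule eq_vecI) (use v 0 1 2 3 4 5 in \<open>auto dest!: less_6_cases\<close>)
qed blast

text \<open>Column \<open>i\<close> of \<open>R\<close> holds the coordinates of e_i in the basis
  N^k e_3.\<close>

definition R :: "'a mat" where
  "R = (SOME R. R \<in> carrier_mat 6 6 \<and> P * R = 1\<^sub>m 6 \<and> R * P = 1\<^sub>m 6)"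

lemma R: "R \<in> carrier_mat 6 6" and P_R: "P * R = 1\<^sub>m 6" and R_P: "R * P = 1\<^sub>m 6"
  using someI_ex[OF P_invertible] unfolding R_def by auto

lemma N_similar: "N = P * shift_mat 6 * R"
proof -
  have "N = N * P * R" using N P R by (simp add: assoc_mult_mat[of _ 6 6 _ 6 _ 6] P_R)
  then show ?thesis by (simp add: N_P)
qed

lemma mat_tr_N_pow:
  assumes "k > 0"
  shows "mat_tr (N ^\<^sub>m k) = 0"
proof -
  let ?S = "shift_mat 6 ^\<^sub>m k :: 'a mat"
  have S: "?S \<in> carrier_mat 6 6" by simp
  have "mat_tr (N ^\<^sub>m k) = mat_tr (P * ?S * R)"
    unfolding N_similar using P R by (simp add: similar_pow_mat R_P P_R)
  also have "\<dots> = mat_tr (R * (P * ?S))" using P R S by (intro mat_tr_comm) (auto simp: mult_carrier_mat[of _ 6 6 _ 6])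
  also have "R * (P * ?S) = ?S" using P R S left_mult_one_mat[OF S] by (simp add: R_P flip: assoc_mult_mat[of _ 6 6 _ 6 _ 6])
  also have "mat_tr ?S = 0"
    unfolding mat_tr_def by (rule sum.neutral) (use assms in \<open>auto simp: shift_mat_pow_index\<close>)
  finally show ?thesis .
qed

end

section \<open>The second root in the cyclic basis of the first\<close>

lemma sum_lessThan_4: "(\<Sum>k<4. f k) = f 0 + f 1 + f 2 + f (3::nat)"
  by (simp add: eval_nat_numeral)

lemma sum_lessThan_5: "(\<Sum>k<5. f k) = f 0 + f 1 + f 2 + f 3 + f (4::nat)"
  by (simp add: eval_nat_numeral)

context transvection_root
begin

text \<open>This is A u^-1 - 1, because u^-1 = 1 - L. The locale does not assume that A u^-1 is a
  root; that information enters through hypotheses on traces or on entries of \<open>N\<close> and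
  its square.\<close>

abbreviation N' :: "'a mat" where "N' \<equiv> N - A * log_mat"

lemma N'_carrier: "N' \<in> carrier_mat 6 6"
  using A by (intro minus_carrier_mat) (auto simp: mult_carrier_mat[of _ 6 6 _ 6])

lemma A_index: "i < 6 \<Longrightarrow> j < 6 \<Longrightarrow> A $$ (i, j) = (if i = j then 1 else 0) + N $$ (i, j)"
  using A by (auto simp: N_def)

lemma N'_index:
  assumes "i < 6" "j < 6"
  shows "N' $$ (i, j) = N $$ (i, j) - (if j = 1 then A $$ (i, 0) else if j = 3 then - A $$ (i, 4)
     else if j = 5 then 2 * A $$ (i, 2) else 0)"
proof -
  have "A * log_mat \<in> carrier_mat 6 6" using A by (simp add: mult_carrier_mat[of _ 6 6 _ 6])
  then have "N' $$ (i, j) = N $$ (i, j) - (A * log_mat) $$ (i, j)"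
    using assms by (intro index_minus_mat(1)) auto
  then show ?thesis using assms by (simp only: mult_log_mat_index[OF A])
qed

lemma mat_tr_pow_1_2:
  assumes "B \<in> carrier_mat 6 6"
  shows "mat_tr (B ^\<^sub>m 1) = (\<Sum>i<6. B $$ (i, i))"
    and "mat_tr (B ^\<^sub>m 2) = (\<Sum>i<6. \<Sum>j<6. B $$ (i, j) * B $$ (j, i))"
  using assms by (auto simp: mat_tr_def numeral_2_eq_2 index_mult_mat_sum[of _ 6 6 _ 6] simp del: index_mult_mat(1) intro!: sum.cong)

text \<open>Column 0 and row 3 of \<open>N\<close> vanish, so only the long root part of L
  contributes to the trace of A L, namely 2 N(5, 2). Once this is 0, the trace of (A L)^2 vanishes
  too, and the cross terms in the trace of \<open>N' ^\<^sub>m 2\<close> leave only the multiple 4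
  of the entry (5, 2) of N^2.\<close>

lemma N_index_5_2:
  assumes "mat_tr (N' ^\<^sub>m 1) = 0" "mat_tr (N' ^\<^sub>m 2) = 0"
  shows "N $$ (5, 2) = 0" "(N ^\<^sub>m 2) $$ (5, 2) = 0"
proof -
  have N0: "N $$ (0, 0) = 0" "N $$ (Suc 0, 0) = 0" "N $$ (2, 0) = 0" "N $$ (3, 0) = 0" "N $$ (4, 0) = 0" "N $$ (5, 0) = 0"
    "N $$ (3, Suc 0) = 0" "N $$ (3, 2) = 0" "N $$ (3, 3) = 0" "N $$ (3, 4) = 0" "N $$ (3, 5) = 0"
    by (simp_all add: N_index_0 N_index_3)
  have tr: "(\<Sum>i<6. N $$ (i, i)) = 0" "(\<Sum>i<6. \<Sum>j<6. N $$ (i, j) * N $$ (j, i)) = 0"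
    using mat_tr_N_pow[of 1] mat_tr_N_pow[of 2] mat_tr_pow_1_2[OF N] by simp_all
  have "2 * N $$ (5, 2) = (\<Sum>i<6. N $$ (i, i)) - (\<Sum>i<6. N' $$ (i, i))"
    by (simp add: sum_lessThan_6 N'_index A_index N0)
  then have "2 * N $$ (5, 2) = 0"
    using tr assms mat_tr_pow_1_2[OF N'_carrier] by simp
  then show n52: "N $$ (5, 2) = 0" using two_neq_0 by simp
  have sq: "(N ^\<^sub>m 2) $$ (5, 2) = (\<Sum>j<6. N $$ (5, j) * N $$ (j, 2))"
    using N by (simp add: numeral_2_eq_2 index_mult_mat_sum[of _ 6 6 _ 6] del: index_mult_mat(1))
  have "4 * (N ^\<^sub>m 2) $$ (5, 2) = (\<Sum>i<6. \<Sum>j<6. N $$ (i, j) * N $$ (j, i)) - (\<Sum>i<6. \<Sum>j<6. N' $$ (i, j) * N' $$ (j, i))"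
    unfolding sq by (simp add: sum_lessThan_6 N'_index A_index N0 n52) (simp add: algebra_simps)
  then have "2 * 2 * (N ^\<^sub>m 2) $$ (5, 2) = 0"
    using tr assms mat_tr_pow_1_2[OF N'_carrier] by simp
  then show "(N ^\<^sub>m 2) $$ (5, 2) = 0" using two_neq_0 by (metis mult_eq_0_iff)
qed

lemma R_index_0: "i < 6 \<Longrightarrow> R $$ (i, 0) = (if i = 5 then inverse c else 0)"
proof -
  assume i: "i < 6"
  have "(R * P) $$ (i, 5) = R $$ (i, 0) * c"
    using R P i by (simp add: index_mult_mat_sum[of _ 6 6 _ 6] sum_lessThan_6 P_index_5 del: index_mult_mat(1))
  then show ?thesis using i c by (auto simp: R_P field_simps split: if_splits)
qed

text \<open>The form at e_i and N^j e_3 is expanded through the coordinates of e_i. Up to sign the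
  left side is an entry of \<open>P\<close>, so entries of \<open>P\<close> become expressions in
  \<open>R\<close> and the known Gram matrix.\<close>

lemma sp_form_P_index:
  assumes "i < 6" "j < 6"
  shows "(sp_form 3 * P) $$ (i, j) = (\<Sum>k<6. R $$ (k, i) * G $$ (k, j))"
proof -
  have "sp_form 3 * P = transpose_mat (P * R) * sp_form 3 * P"
    unfolding P_R using P by (simp add: left_mult_one_mat[OF sp_form_3_carrier])
  also have "\<dots> = transpose_mat R * G"
    unfolding G_def using P R
    by (simp add: transpose_mult[of _ 6 6 _ 6] assoc_mult_mat[of _ 6 6 _ 6 _ 6] mult_carrier_mat[of _ 6 6 _ 6])
  finally show ?thesis
    using R G assms by (simp add: index_mult_mat_sum[of _ 6 6 _ 6] del: index_mult_mat(1))
qed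

text \<open>Rows 5, 1 and 3 of \<open>P\<close> are, up to sign, the pairings of the basis with e_2,
  e_4 and e_0. They are exactly the rows through which \<open>log_mat\<close> acts in
  \<open>mult_log_mat_mult_index\<close>.\<close>

lemma P_index:
  assumes "j < 6"
  shows "P $$ (5, j) = (\<Sum>k<6. R $$ (k, 2) * G $$ (k, j))"
    and "P $$ (1, j) = - (\<Sum>k<6. R $$ (k, 4) * G $$ (k, j))"
    and "P $$ (3, j) = (if j = 0 then 1 else 0)"
proof -
  have row: "(sp_form 3 * P) $$ (i, j) = (if i < 3 then P $$ (i + 3, j) else - P $$ (i - 3, j))" if "i < 6" for i
    using less_6_cases[OF that] P assms
    by (auto simp: index_mult_mat_sum[of _ 6 6 _ 6] sum_lessThan_6 sp_form_3_index simp del: index_mult_mat(1))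
  show "P $$ (5, j) = (\<Sum>k<6. R $$ (k, 2) * G $$ (k, j))"
    using row[of 2] sp_form_P_index[of 2 j] assms by simp
  show "P $$ (1, j) = - (\<Sum>k<6. R $$ (k, 4) * G $$ (k, j))"
    using row[of 4] sp_form_P_index[of 4 j] assms by simp
  have "P $$ (3, j) = (\<Sum>k<6. R $$ (k, 0) * G $$ (k, j))"
    using row[of 0] sp_form_P_index[of 0 j] assms by simp
  then show "P $$ (3, j) = (if j = 0 then 1 else 0)"
    using c less_6_cases[OF assms] by (auto simp: sum_lessThan_6 R_index_0 G_index_lower)
qed

text \<open>Pairing with N^5 e_3 multiplies the coordinate at e_3 by -c, and N^5 e_3 = c e_0 is
  orthogonal to e_2 and e_4.\<close>

lemma R_index_0_zero: "R $$ (0, 2) = 0" "R $$ (0, 4) = 0"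
  using P_index(1)[of 5] P_index(2)[of 5] P_index_5[of 5] P_index_5[of 1] c
  by (simp_all add: sum_lessThan_6 G_index G_index_lower G_index_0_5)

lemma P_row_5: "P $$ (5, 5) = 0" "P $$ (5, 4) = c * R $$ (Suc 0, 2)" "P $$ (5, 3) = c * R $$ (Suc 0, 2) - c * R $$ (2, 2)"
  "P $$ (5, 2) = G $$ (Suc 0, 2) * R $$ (Suc 0, 2) + c * R $$ (3, 2)"
  using P_index(1)[of 5] P_index(1)[of 4] P_index(1)[of 3] P_index(1)[of 2] R_index_0_zero
  by (simp_all add: sum_lessThan_6 G_index G_index_lower G_index_0_5 algebra_simps)

lemma P_row_1: "P $$ (Suc 0, 5) = 0" "P $$ (Suc 0, 4) = - c * R $$ (Suc 0, 4)" "P $$ (Suc 0, 3) = c * R $$ (2, 4) - c * R $$ (Suc 0, 4)"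
  using P_index(2)[of 5] P_index(2)[of 4] P_index(2)[of 3] R_index_0_zero
  by (simp_all add: sum_lessThan_6 G_index G_index_lower G_index_0_5 algebra_simps)

lemma N_index_R:
  assumes "i < 6" "j < 6"
  shows "N $$ (i, j) = (\<Sum>k<5. P $$ (i, Suc k) * R $$ (k, j))"
    and "(N ^\<^sub>m 2) $$ (i, j) = (\<Sum>k<4. P $$ (i, Suc (Suc k)) * R $$ (k, j))"
proof -
  have S: "P * shift_mat 6 \<in> carrier_mat 6 6" "P * shift_mat 6 * shift_mat 6 \<in> carrier_mat 6 6"
    using P by (auto simp: mult_carrier_mat[of _ 6 6 _ 6])
  have "(P * shift_mat 6 * R) $$ (i, j) = (\<Sum>k<6. (if Suc k < 6 then P $$ (i, Suc k) else 0) * R $$ (k, j))"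
    using P assms by (simp add: index_mult_mat_sum[OF S(1) R] mult_shift_mat_index[of _ 6 6] del: index_mult_mat(1))
  then show "N $$ (i, j) = (\<Sum>k<5. P $$ (i, Suc k) * R $$ (k, j))"
    by (subst N_similar) (simp add: eval_nat_numeral)
  have "N ^\<^sub>m 2 = P * shift_mat 6 ^\<^sub>m 2 * R"
    using P R by (subst N_similar) (simp add: similar_pow_mat[of _ 6] R_P P_R)
  also have "P * shift_mat 6 ^\<^sub>m 2 = P * shift_mat 6 * shift_mat 6"
    using P by (simp add: numeral_2_eq_2 assoc_mult_mat[of _ 6 6 _ 6 _ 6] left_mult_one_mat[OF shift_mat_carrier])
  finally have "(N ^\<^sub>m 2) $$ (i, j) = (\<Sum>k<6. (if Suc (Suc k) < 6 then P $$ (i, Suc (Suc k)) else 0) * R $$ (k, j))"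
    using P S assms by (auto simp add: index_mult_mat_sum[OF S(2) R] mult_shift_mat_index[of _ 6 6] simp del: index_mult_mat(1) intro!: sum.cong)
  then show "(N ^\<^sub>m 2) $$ (i, j) = (\<Sum>k<4. P $$ (i, Suc (Suc k)) * R $$ (k, j))"
    by (simp add: eval_nat_numeral)
qed

text \<open>In the coordinates of e_2 the two entries become
  \<open>c * (R $$ (1, 2))\<^sup>2\<close> and then \<open>- c * (R $$ (2, 2))\<^sup>2\<close>, and
  a square in a field vanishes only at 0. Together with \<open>R $$ (0, 2) = 0\<close> this puts e_2
  into the span of N^3 e_3, N^4 e_3, N^5 e_3.\<close>

lemma R_column_2:
  assumes "N $$ (5, 2) = 0" "(N ^\<^sub>m 2) $$ (5, 2) = 0"
  shows "R $$ (1, 2) = 0" "R $$ (2, 2) = 0"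
proof -
  have "c * (R $$ (1, 2))\<^sup>2 = (N ^\<^sub>m 2) $$ (5, 2)"
    by (simp add: N_index_R(2) sum_lessThan_4 R_index_0_zero P_row_5 power2_eq_square algebra_simps flip: numeral_2_eq_2)
  then show 1: "R $$ (1, 2) = 0" using assms c by simp
  have "- c * (R $$ (2, 2))\<^sup>2 = N $$ (5, 2)"
    using 1 by (simp add: N_index_R(1) sum_lessThan_5 R_index_0_zero P_row_5 power2_eq_square algebra_simps)
  then show "R $$ (2, 2) = 0" using assms c by simp
qed


lemma strictly_lower_pow_5:
  assumes D: "(D :: 'a mat) \<in> carrier_mat 6 6"
    and low: "\<And>i j. i < 6 \<Longrightarrow> j < 6 \<Longrightarrow> i \<le> j \<Longrightarrow> D $$ (i, j) = 0"
    and ij: "i < 6" "j < 6"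
  shows "(D ^\<^sub>m 5) $$ (i, j) = (if i = 5 \<and> j = 0 then D $$ (5, 4) * D $$ (4, 3) * D $$ (3, 2) * D $$ (2, 1) * D $$ (1, 0) else 0)"
proof -
  \<comment> \<open>Reversing the basis turns strictly lower into strictly upper triangular.\<close>
  let ?p = "\<lambda>i. 5 - i :: nat"
  have p: "bij_betw ?p {..<6} {..<6}" by (rule bij_betwI[of _ _ _ ?p]) auto
  have up: "D $$ (?p i, ?p j) = 0" if "i < 6" "j \<le> i" for i j
    using that by (intro low) auto
  have pp: "?p (5 - i) = i" "?p (5 - j) = j" using ij by auto
  note main = strict_upper_pow[OF D p up, of "5 - i" "5 - j" 5, unfolded pp]
  show ?thesis
  proof (cases "i = 5 \<and> j = 0")
    case True
    then show ?thesis using main(2) by (simp add: lessThan_Suc eval_nat_numeral mult_ac)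
  next
    case False
    then have "5 - j < 5 - i + 5" using ij by auto
    then show ?thesis using main(1) False ij by auto
  qed
qed

text \<open>Here x is \<open>R $$ (3, 2)\<close> and y is \<open>R $$ (1, 4)\<close>. In the cyclic
  basis \<open>N\<close> becomes the shift S, \<open>log_mat\<close> becomes \<open>Y\<close>, and
  \<open>N'\<close> becomes \<open>D\<close>, which is S - (1 + S) Y. The vanishing coordinates of
  e_2 make \<open>D\<close> strictly lower triangular, so its fifth power is the product of the
  subdiagonal times that of S. The factors 1 + y sit at both ends of the subdiagonal, 1 - 2 c x^2 in
  the middle, and the other two entries are 1.\<close>

lemma N'_pow_5:
  assumes "N $$ (5, 2) = 0" "(N ^\<^sub>m 2) $$ (5, 2) = 0"
  shows "N' ^\<^sub>m 5 = ((1 + R $$ (1, 4))\<^sup>2 * (1 - 2 * c * (R $$ (3, 2))\<^sup>2)) \<cdot>\<^sub>m N ^\<^sub>m 5"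
proof -
  let ?S = "shift_mat 6 :: 'a mat"
  define Y where "Y = R * log_mat * P"
  define D where "D = ?S - (Y + ?S * Y)"
  have Y: "Y \<in> carrier_mat 6 6" using P R by (simp add: Y_def mult_carrier_mat[of _ 6 6 _ 6])
  have D: "D \<in> carrier_mat 6 6" using Y by (simp add: D_def minus_carrier_mat mult_carrier_mat[of _ 6 6 _ 6])
  have Y_index: "Y $$ (i, j) = R $$ (i, 0) * P $$ (1, j) - R $$ (i, 4) * P $$ (3, j) + 2 * R $$ (i, 2) * P $$ (5, j)"
    if "i < 6" "j < 6" for i j
    using mult_log_mat_mult_index[OF R P that] by (simp add: Y_def)
  have D_index: "D $$ (i, j) = (if i = Suc j then 1 else 0) - (Y $$ (i, j) + (if i > 0 then Y $$ (i - 1, j) else 0))"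
    if "i < 6" "j < 6" for i j
  proof -
    have "D $$ (i, j) = ?S $$ (i, j) - (Y $$ (i, j) + (?S * Y) $$ (i, j))"
      unfolding D_def using that Y carrier_matD[OF mult_carrier_mat[OF shift_mat_carrier Y]] by auto
    then show ?thesis using that by (simp add: shift_mat_mult_index[OF Y that]) (simp add: shift_mat_def)
  qed
  have N'_D: "N' = P * D * R"
  proof -
    have YR: "P * (Y + ?S * Y) * R = A * log_mat"
    proof -
      have "P * (Y + ?S * Y) * R = P * (Y * R) + P * ?S * (Y * R)"
        using P R Y by (simp add: add_mult_distrib_mat[of _ 6 6 _ _ 6] mult_add_distrib_mat[of _ 6 6 _ 6]
          assoc_mult_mat[of _ 6 6 _ 6 _ 6] mult_carrier_mat[of _ 6 6 _ 6])
      also have "Y * R = R * log_mat"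
        using P R unfolding Y_def by (simp add: assoc_mult_mat[of _ 6 6 _ 6 _ 6] mult_carrier_mat[of _ 6 6 _ 6] P_R right_mult_one_mat[OF log_mat_carrier])
      also have "P * (R * log_mat) = log_mat"
        using P R by (simp add: P_R left_mult_one_mat[OF log_mat_carrier] flip: assoc_mult_mat[of _ 6 6 _ 6 _ 6])
      also have "P * ?S * (R * log_mat) = N * log_mat"
        using P R by (subst N_similar) (simp add: assoc_mult_mat[of _ 6 6 _ 6 _ 6] mult_carrier_mat[of _ 6 6 _ 6])
      also have "log_mat + N * log_mat = A * log_mat"
        using N by (subst A_eq) (simp add: add_mult_distrib_mat[of _ 6 6 _ _ 6] left_mult_one_mat[OF log_mat_carrier])
      finally show ?thesis .
    qed
    have "P * D * R = P * ?S * R - P * (Y + ?S * Y) * R"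
      using P R Y unfolding D_def
      by (simp add: minus_mult_distrib_mat[of _ 6 6 _ _ 6] mult_minus_distrib_mat[of _ 6 6 _ 6] mult_carrier_mat[of _ 6 6 _ 6])
    then show ?thesis by (simp add: YR flip: N_similar)
  qed
  note r = R_column_2[OF assms] R_index_0_zero R_index_0
  have p: "P $$ (5, 5) = 0" "P $$ (5, 4) = 0" "P $$ (5, 3) = 0" "P $$ (5, 2) = c * R $$ (3, 2)"
    "P $$ (3, Suc 0) = 0" "P $$ (3, 2) = 0" "P $$ (3, 3) = 0" "P $$ (3, 4) = 0" "P $$ (3, 5) = 0"  "P $$ (3, 0) = 1"
    using r P_row_5 by (simp_all add: P_index)
  have low: "D $$ (i, j) = 0" if "i < 6" "j < 6" "i \<le> j" for i j
    using less_6_cases[OF that(1)] less_6_cases[OF that(2)] that(3)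
    by (elim disjE) (simp_all add: D_index Y_index r[simplified] p P_row_1)
  have sub: "D $$ (5, 4) = 1 + R $$ (1, 4)" "D $$ (4, 3) = 1" "D $$ (3, 2) = 1 - 2 * c * (R $$ (3, 2))\<^sup>2"
    "D $$ (2, Suc 0) = 1" "D $$ (Suc 0, 0) = 1 + R $$ (1, 4)"
    using c by (simp_all add: D_index Y_index r[simplified] p P_row_1 power2_eq_square)
  let ?d = "(1 + R $$ (1, 4))\<^sup>2 * (1 - 2 * c * (R $$ (3, 2))\<^sup>2)"
  have "D ^\<^sub>m 5 = ?d \<cdot>\<^sub>m ?S ^\<^sub>m 5"
  proof (rule eq_matI)
    fix i j assume "i < dim_row (?d \<cdot>\<^sub>m ?S ^\<^sub>m 5)" "j < dim_col (?d \<cdot>\<^sub>m ?S ^\<^sub>m 5)"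
    then have ij: "i < 6" "j < 6" by auto
    then show "(D ^\<^sub>m 5) $$ (i, j) = (?d \<cdot>\<^sub>m ?S ^\<^sub>m 5) $$ (i, j)"
      by (subst strictly_lower_pow_5[OF D low ij]) (auto simp: shift_mat_pow_index sub power2_eq_square algebra_simps)
  qed (use D in auto)
  then have "N' ^\<^sub>m 5 = P * (?d \<cdot>\<^sub>m ?S ^\<^sub>m 5) * R"
    unfolding N'_D by (simp only: similar_pow_mat[OF P R D R_P P_R])
  also have "\<dots> = ?d \<cdot>\<^sub>m (P * ?S ^\<^sub>m 5 * R)"
    using P R by (simp add: mult_smult_distrib[of _ 6 6 _ 6] mult_smult_assoc_mat[of _ 6 6 _ 6] mult_carrier_mat[of _ 6 6 _ 6])
  also have "P * ?S ^\<^sub>m 5 * R = N ^\<^sub>m 5"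
    using P R by (subst N_similar) (simp only: similar_pow_mat[OF P R shift_mat_carrier R_P P_R])
  finally show ?thesis .
qed

text \<open>Now e_2 is a combination of N^4 e_3 and e_0 with a nonzero coefficient at N^4 e_3. Since
  e_2 has no component along e_1, neither has N^4 e_3, and that component is
  \<open>- c * R $$ (1, 4)\<close>.\<close>

lemma R_index_3_2:
  assumes "N $$ (5, 2) = 0" "(N ^\<^sub>m 2) $$ (5, 2) = 0" "R $$ (3, 2) = 0"
  shows "R $$ (1, 4) = 0" "\<And>i. i < 6 \<Longrightarrow> i \<noteq> 0 \<Longrightarrow> N $$ (i, 2) = 0"
proof -
  note r = R_column_2[OF assms(1,2)] R_index_0_zero assms(3)
  have PR: "(\<Sum>k<6. P $$ (i, k) * R $$ (k, j)) = (if i = j then 1 else 0)" if "i < 6" "j < 6" for i j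
    using that P_R index_mult_mat_sum[OF P R that] by simp
  have "R $$ (4, 2) \<noteq> 0"
    using PR[of 2 2] r by (auto simp: sum_lessThan_6 P_index_5)
  moreover have "c * R $$ (1, 4) * R $$ (4, 2) = 0"
    using PR[of 1 2] r P_row_1 by (simp add: sum_lessThan_6)
  ultimately show "R $$ (1, 4) = 0" using c by simp
  show "N $$ (i, 2) = 0" if "i < 6" "i \<noteq> 0" for i
    using that r by (simp add: N_index_R(1) sum_lessThan_5 P_index_5)
qed

text \<open>This converse shows that flag roots satisfy the hypotheses of \<open>N'_pow_5\<close>.
  By R N = S R, applying \<open>N\<close> moves coordinates one place up, so coordinate 3 of e_2 is
  coordinate 4 of N e_2, which is 0 for a multiple of e_0.\<close>

lemma R_column_2_if:
  assumes "\<And>i. i < 6 \<Longrightarrow> i \<noteq> 0 \<Longrightarrow> N $$ (i, 2) = 0"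
  shows "N $$ (5, 2) = 0" "(N ^\<^sub>m 2) $$ (5, 2) = 0" "R $$ (3, 2) = 0"
proof -
  show "N $$ (5, 2) = 0" by (simp add: assms)
  show "(N ^\<^sub>m 2) $$ (5, 2) = 0"
    using N assms by (simp add: numeral_2_eq_2 index_mult_mat_sum[of _ 6 6 _ 6] sum_lessThan_6 N_index_0 del: index_mult_mat(1))
  have "R * N = shift_mat 6 * R"
    using P R by (subst N_similar) (simp add: R_P left_mult_one_mat[OF shift_mat_carrier] mult_carrier_mat[of _ 6 6 _ 6] flip: assoc_mult_mat[of _ 6 6 _ 6 _ 6])
  then have "(R * N) $$ (4, 2) = R $$ (3, 2)"
    using shift_mat_mult_index[OF R, of 4 2] by simp
  then show "R $$ (3, 2) = 0"
    using N R assms by (simp add: index_mult_mat_sum[of _ 6 6 _ 6] sum_lessThan_6 R_index_0 del: index_mult_mat(1))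
qed

end

section \<open>The roots of the two transvections\<close>

lemma (in transvection_root) mult_one_minus_log: "A * (1\<^sub>m 6 - log_mat) = 1\<^sub>m 6 + N'"
proof -
  have AL: "A * log_mat \<in> carrier_mat 6 6" using A by (simp add: mult_carrier_mat[of _ 6 6 _ 6])
  have "A * (1\<^sub>m 6 - log_mat) = A - A * log_mat"
    using A by (simp add: mult_minus_distrib_mat[of _ 6 6 _ 6])
  also have "\<dots> = 1\<^sub>m 6 + N'"
    using A AL by (intro eq_matI) (auto simp: A_index simp del: index_mult_mat(1))
  finally show ?thesis .
qed

lemma one_minus_log_mat:
  "1\<^sub>m 6 - log_mat \<in> carrier_mat 6 6" "1\<^sub>m 6 + log_mat \<in> carrier_mat 6 6"
  by (simp_all add: minus_carrier_mat)

lemma log_mat_square: "log_mat * log_mat = 0\<^sub>m 6 6"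
  by (rule eq_matI) (auto simp: mult_log_mat_index[OF log_mat_carrier] simp del: index_mult_mat(1), auto simp: log_mat_def)

lemma log_mat_inverse:
  "(1\<^sub>m 6 + log_mat) * (1\<^sub>m 6 - log_mat) = 1\<^sub>m 6"
proof -
  have "(1\<^sub>m 6 + log_mat) * (1\<^sub>m 6 - log_mat) = (1\<^sub>m 6 + log_mat) - (1\<^sub>m 6 + log_mat) * log_mat"
    by (simp add: mult_minus_distrib_mat[of _ 6 6 _ 6] right_mult_one_mat[of _ 6 6])
  also have "(1\<^sub>m 6 + log_mat) * log_mat = log_mat + 0\<^sub>m 6 6"
    by (simp add: add_mult_distrib_mat[of _ 6 6 _ _ 6] log_mat_square left_mult_one_mat[OF log_mat_carrier])
  also have "(1\<^sub>m 6 + log_mat) - (log_mat + 0\<^sub>m 6 6) = 1\<^sub>m 6"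
    by (rule eq_matI) auto
  finally show ?thesis .
qed

lemma mult_sp_form_3_index:
  assumes "A \<in> carrier_mat 6 6" "i < 6" "j < 6"
  shows "(A * sp_form 3) $$ (i, j) = (if j < 3 then - A $$ (i, j + 3) else A $$ (i, j - 3))"
  using less_6_cases[OF assms(3)] assms
  by (auto simp: index_mult_mat_sum[of _ 6 6 _ 6] sum_lessThan_6 sp_form_3_index simp del: index_mult_mat(1))

text \<open>The form evaluated at columns \<open>i\<close> and \<open>j\<close>. For an explicit
  matrix, membership reduces to evaluating 36 such equations.\<close>

lemma sp_3_iff:
  assumes "A \<in> carrier_mat 6 6"
  shows "A \<in> carrier (Sp 3) \<longleftrightarrow> (\<forall>i<6. \<forall>j<6.
    A $$ (0, i) * A $$ (3, j) + A $$ (1, i) * A $$ (4, j) + A $$ (2, i) * A $$ (5, j)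
    - A $$ (3, i) * A $$ (0, j) - A $$ (4, i) * A $$ (1, j) - A $$ (5, i) * A $$ (2, j)
    = (if j = i + 3 then 1 else if i = j + 3 then - 1 else 0))"
proof -
  have eq: "(transpose_mat A * sp_form 3 * A) $$ (i, j) = 
    A $$ (0, i) * A $$ (3, j) + A $$ (1, i) * A $$ (4, j) + A $$ (2, i) * A $$ (5, j)
    - A $$ (3, i) * A $$ (0, j) - A $$ (4, i) * A $$ (1, j) - A $$ (5, i) * A $$ (2, j)" if "i < 6" "j < 6" for i j
    using that assms mult_carrier_mat[of "transpose_mat A" 6 6 "sp_form 3" 6]
    by (simp del: index_mult_mat(1) add: index_mult_mat_sum[of "transpose_mat A * sp_form 3" 6 6 _ 6] sum_lessThan_6 mult_sp_form_3_index)
  have "A \<in> carrier (Sp 3) \<longleftrightarrow> (\<forall>i<6. \<forall>j<6. (transpose_mat A * sp_form 3 * A) $$ (i, j) = sp_form 3 $$ (i, j))"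
    unfolding carrier_Sp_3 using assms carrier_matD[OF sp_form_3_carrier[where ?'a = 'a]]
    by (auto intro!: eq_matI simp del: index_mult_mat(1))
  then show ?thesis by (simp add: eq sp_form_3_index cong: conj_cong imp_cong)
qed

lemma Sp_3_carrier_mat: "A \<in> carrier (Sp 3) \<Longrightarrow> A \<in> carrier_mat 6 6"
  by (simp add: carrier_Sp_3)

lemma all_less_6: "(\<forall>i<6. Q i) \<longleftrightarrow> Q 0 \<and> Q 1 \<and> Q 2 \<and> Q 3 \<and> Q 4 \<and> Q (5::nat)"
  by (auto dest: less_6_cases)

lemma one_minus_log_mat_Sp: "1\<^sub>m 6 - log_mat \<in> carrier (Sp 3)"
  unfolding sp_3_iff[OF one_minus_log_mat(1)] all_less_6 by (simp add: log_mat_def)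

lemma one_plus_log_mat_Sp: "1\<^sub>m 6 + log_mat \<in> carrier (Sp 3)"
  unfolding sp_3_iff[OF one_minus_log_mat(2)] all_less_6 by (simp add: log_mat_def)

lemma one_plus_corner_mat_Sp: "1\<^sub>m 6 + corner_mat c \<in> carrier (Sp 3)"
proof -
  have "1\<^sub>m 6 + corner_mat c \<in> carrier_mat 6 6" by simp
  then show ?thesis by (simp add: sp_3_iff all_less_6 corner_mat_def)
qed

section \<open>Similitudes and the two sets of roots\<close>

definition half_diag :: "'a :: comm_ring_1 \<Rightarrow> 'a mat" where
  "half_diag t = mat 6 6 (\<lambda>(i, j). if i = j then (if i < 3 then 1 else t) else 0)"

lemma half_diag_carrier [simp]: "half_diag t \<in> carrier_mat 6 6"
  by (simp add: half_diag_def)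

lemma half_diag_dim [simp]: "dim_row (half_diag t) = 6" "dim_col (half_diag t) = 6"
  by (simp_all add: half_diag_def)

lemma half_diag_mult_index:
  assumes "A \<in> carrier_mat 6 6" "i < 6" "j < 6"
  shows "(half_diag t * A) $$ (i, j) = (if i < 3 then 1 else t) * A $$ (i, j)"
    and "(A * half_diag t) $$ (i, j) = A $$ (i, j) * (if j < 3 then 1 else t)"
proof -
  have "(half_diag t * A) $$ (i, j) = (\<Sum>k<6. if k = i then (if i < 3 then 1 else t) * A $$ (k, j) else 0)"
    unfolding index_mult_mat_sum[OF half_diag_carrier assms]
    using assms by (intro sum.cong) (auto simp: half_diag_def)
  then show "(half_diag t * A) $$ (i, j) = (if i < 3 then 1 else t) * A $$ (i, j)" using assms by simp
  have "(A * half_diag t) $$ (i, j) = (\<Sum>k<6. if k = j then A $$ (i, k) * (if j < 3 then 1 else t) else 0)"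
    unfolding index_mult_mat_sum[OF assms(1) half_diag_carrier assms(2,3)]
    using assms by (intro sum.cong) (auto simp: half_diag_def)
  then show "(A * half_diag t) $$ (i, j) = A $$ (i, j) * (if j < 3 then 1 else t)" using assms by simp
qed

lemma half_diag_inverse: "s * t = 1 \<Longrightarrow> half_diag s * half_diag t = 1\<^sub>m 6"
  by (rule eq_matI) (auto simp: half_diag_mult_index[OF half_diag_carrier] simp del: index_mult_mat(1), auto simp: half_diag_def)

lemma half_diag_conj_index:
  assumes "A \<in> carrier_mat 6 6" "i < 6" "j < 6"
  shows "(half_diag s * A * half_diag t) $$ (i, j) = (if i < 3 then 1 else s) * A $$ (i, j) * (if j < 3 then 1 else t)"
  using assms mult_carrier_mat[OF half_diag_carrier assms(1)]
  by (simp add: half_diag_mult_index del: index_mult_mat(1))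

text \<open>\<open>half_diag t\<close> is a symplectic similitude of multiplier \<open>t\<close> and
  so normalises the symplectic group: each term of the form combines one row below 3 with one row
  from 3 on, so all terms acquire the same factor \<open>s\<close>.\<close>

lemma half_diag_conj_Sp:
  assumes st: "s * t = (1 :: 'a :: comm_ring_1)" and A: "A \<in> carrier (Sp 3)"
  shows "half_diag s * A * half_diag t \<in> carrier (Sp 3)"
proof -
  have cA: "A \<in> carrier_mat 6 6" using A by (rule Sp_3_carrier_mat)
  have c: "half_diag s * A * half_diag t \<in> carrier_mat 6 6"
    using cA by (simp add: mult_carrier_mat[of _ 6 6 _ 6])
  define C where "C = half_diag s * A * half_diag t"
  have C: "C $$ (i, j) = (if i < 3 then 1 else s) * A $$ (i, j) * (if j < 3 then 1 else t)" if "i < 6" "j < 6" for i j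
    unfolding C_def by (rule half_diag_conj_index[OF cA that])
  have "C \<in> carrier (Sp 3)"
    unfolding sp_3_iff[OF c[folded C_def]]
  proof (intro allI impI)
    fix i j :: nat assume ij: "i < 6" "j < 6"
    have *: "A $$ (0, i) * A $$ (3, j) + A $$ (1, i) * A $$ (4, j) + A $$ (2, i) * A $$ (5, j)
    - A $$ (3, i) * A $$ (0, j) - A $$ (4, i) * A $$ (1, j) - A $$ (5, i) * A $$ (2, j)
    = (if j = i + 3 then 1 else if i = j + 3 then - 1 else 0)"
      using A ij by (simp add: sp_3_iff[OF cA])
    have "C $$ (0, i) * C $$ (3, j) + C $$ (1, i) * C $$ (4, j) + C $$ (2, i) * C $$ (5, j)
    - C $$ (3, i) * C $$ (0, j) - C $$ (4, i) * C $$ (1, j) - C $$ (5, i) * C $$ (2, j)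
    = (A $$ (0, i) * A $$ (3, j) + A $$ (1, i) * A $$ (4, j) + A $$ (2, i) * A $$ (5, j)
    - A $$ (3, i) * A $$ (0, j) - A $$ (4, i) * A $$ (1, j) - A $$ (5, i) * A $$ (2, j))
     * (s * (if i < 3 then 1 else t) * (if j < 3 then 1 else t))"
      using ij by (simp add: C) (simp add: algebra_simps)
    also have "\<dots> = (if j = i + 3 then 1 else if i = j + 3 then - 1 else 0)"
      unfolding * using st ij by auto
    finally show "C $$ (0, i) * C $$ (3, j) + C $$ (1, i) * C $$ (4, j) + C $$ (2, i) * C $$ (5, j)
    - C $$ (3, i) * C $$ (0, j) - C $$ (4, i) * C $$ (1, j) - C $$ (5, i) * C $$ (2, j)
      = (if j = i + 3 then 1 else if i = j + 3 then - 1 else 0)" .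
  qed
  then show ?thesis by (simp add: C_def)
qed

text \<open>The set G_5(u, g) of the symplectic group for g = 1 + E(c), with u^-1 written out as 1 -
  L.\<close>

definition pair_roots :: "'a :: field \<Rightarrow> 'a mat set" where
  "pair_roots c = {A \<in> carrier (Sp 3). A ^\<^sub>m 5 = 1\<^sub>m 6 + corner_mat c
     \<and> (A * (1\<^sub>m 6 - log_mat)) ^\<^sub>m 5 = 1\<^sub>m 6 + corner_mat c}"

text \<open>The condition on column 2 says that A e_2 - e_2 is a multiple of e_0. It is free of u
  and stable under conjugation by diagonal matrices, so the similitudes act on these sets.\<close>

definition flag_roots :: "'a :: field \<Rightarrow> 'a mat set" where
  "flag_roots c = {A \<in> carrier (Sp 3). A ^\<^sub>m 5 = 1\<^sub>m 6 + corner_mat c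
     \<and> (\<forall>i<6. i \<noteq> 0 \<longrightarrow> A $$ (i, 2) = (if i = 2 then 1 else 0))}"

lemma half_diag_conj_flag_roots:
  assumes st: "s * t = 1" and A: "A \<in> flag_roots c"
  shows "half_diag s * A * half_diag t \<in> flag_roots (c * t)"
proof -
  have cA: "A \<in> carrier_mat 6 6" and sp: "A \<in> carrier (Sp 3)" and pow: "A ^\<^sub>m 5 = 1\<^sub>m 6 + corner_mat c"
    using A by (auto simp: flag_roots_def Sp_3_carrier_mat)
  have ts: "t * s = 1" using st by (simp add: mult.commute)
  have "(half_diag s * A * half_diag t) ^\<^sub>m 5 = half_diag s * (1\<^sub>m 6 + corner_mat c) * half_diag t"
    using similar_pow_mat[OF half_diag_carrier half_diag_carrier cA half_diag_inverse[OF ts] half_diag_inverse[OF st], of 5] pow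
    by simp
  also have "\<dots> = 1\<^sub>m 6 + corner_mat (c * t)"
    using st by (intro eq_matI) (auto simp: half_diag_conj_index simp del: index_mult_mat(1), auto simp: corner_mat_def)
  finally show ?thesis
    using half_diag_conj_Sp[OF st sp] A by (auto simp: flag_roots_def half_diag_conj_index[OF cA] simp del: index_mult_mat(1))
qed

lemma card_flag_roots:
  assumes st: "s * t = 1"
  shows "card (flag_roots (c * t)) = card (flag_roots c)"
proof -
  have ts: "t * s = 1" using st by (simp add: mult.commute)
  have inv: "half_diag t * (half_diag s * A * half_diag t) * half_diag s = A"
    if "A \<in> carrier_mat 6 6" "s * t = 1" "t * s = 1" for A and s t :: 'a
  proof -
    have "half_diag t * (half_diag s * A * half_diag t) * half_diag s
      = (half_diag t * half_diag s) * A * (half_diag t * half_diag s)"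
      using that by (simp add: assoc_mult_mat[of _ 6 6 _ 6 _ 6] mult_carrier_mat[of _ 6 6 _ 6])
    then show ?thesis using that by (simp add: half_diag_inverse)
  qed
  have "bij_betw (\<lambda>A. half_diag s * A * half_diag t) (flag_roots c) (flag_roots (c * t))"
  proof (rule bij_betwI[of _ _ _ "\<lambda>A. half_diag t * A * half_diag s"])
    show "(\<lambda>A. half_diag t * A * half_diag s) \<in> flag_roots (c * t) \<rightarrow> flag_roots c"
      using half_diag_conj_flag_roots[OF ts, of _ "c * t"] by (auto simp: mult.assoc ts)
  qed (use half_diag_conj_flag_roots[OF st, of _ c] in \<open>auto simp: inv st ts flag_roots_def Sp_3_carrier_mat\<close>)
  then show ?thesis by (simp add: bij_betw_same_card)
qed

lemma mult_mem_Sp_3: "A \<in> carrier (Sp 3) \<Longrightarrow> B \<in> carrier (Sp 3) \<Longrightarrow> A * B \<in> carrier (Sp 3 :: 'a :: field mat monoid)"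
  using monoid.m_closed[OF group.is_monoid[OF group_Sp[of 3, where ?'a = 'a]], of A B] by (simp add: Sp_def)

section \<open>The isotropic flag, its Borel subgroup and the unitriangular matrices\<close>

definition flag_perm :: "nat \<Rightarrow> nat" where
  "flag_perm i = (if i < 3 then i else 8 - i)"

lemma flag_perm_less: "i < 6 \<Longrightarrow> flag_perm i < 6"
  by (auto simp: flag_perm_def)

lemma flag_perm_flag_perm: "i < 6 \<Longrightarrow> flag_perm (flag_perm i) = i"
  by (auto simp: flag_perm_def)

lemma bij_betw_flag_perm: "bij_betw flag_perm {..<6} {..<6}"
  by (rule bij_betwI[of _ _ _ flag_perm]) (auto simp: flag_perm_less flag_perm_flag_perm)

text \<open>\<open>flag_perm\<close> arranges the basis as e_0, e_1, e_2, e_5, e_4, e_3, where the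
  form pairs position i with position 5 - i. Initial segments thus span a self-dual full flag, and
  its stabiliser consists of the symplectic matrices that are upper triangular in this
  order.\<close>

definition borel_Sp :: "'a :: field mat set" where
  "borel_Sp = {A \<in> carrier (Sp 3). \<forall>i<6. \<forall>j<i. A $$ (flag_perm i, flag_perm j) = 0}"

definition unipotent_Sp :: "'a :: field mat set" where
  "unipotent_Sp = {A \<in> borel_Sp. \<forall>i<6. A $$ (i, i) = 1}"

text \<open>Five steps lead only from the last position of the flag order to the first, that is, to
  row 0 and column 3; the factors are the superdiagonal entries in the order 0, 1, 2, 5, 4,
  3.\<close>

lemma strict_flag_pow_5:
  fixes N :: "'a :: comm_ring_1 mat"
  assumes N: "N \<in> carrier_mat 6 6" and up: "\<And>i j. i < 6 \<Longrightarrow> j \<le> i \<Longrightarrow> N $$ (flag_perm i, flag_perm j) = 0"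
  shows "N ^\<^sub>m 5 = corner_mat (N $$ (0, 1) * N $$ (1, 2) * N $$ (2, 5) * N $$ (5, 4) * N $$ (4, 3))"
proof (rule eq_matI)
  fix i j assume "i < dim_row (corner_mat (N $$ (0, 1) * N $$ (1, 2) * N $$ (2, 5) * N $$ (5, 4) * N $$ (4, 3)))"
    "j < dim_col (corner_mat (N $$ (0, 1) * N $$ (1, 2) * N $$ (2, 5) * N $$ (5, 4) * N $$ (4, 3)))"
  then have ij: "i < 6" "j < 6" by auto
  note main = strict_upper_pow[OF N bij_betw_flag_perm up flag_perm_less[OF ij(1)] flag_perm_less[OF ij(2)], of 5,
      unfolded flag_perm_flag_perm[OF ij(1)] flag_perm_flag_perm[OF ij(2)]]
  show "(N ^\<^sub>m 5) $$ (i, j) = corner_mat (N $$ (0, 1) * N $$ (1, 2) * N $$ (2, 5) * N $$ (5, 4) * N $$ (4, 3)) $$ (i, j)"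
  proof (cases "i = 0 \<and> j = 3")
    case True
    then have "(N ^\<^sub>m 5) $$ (i, j) = (\<Prod>t<5. N $$ (flag_perm t, flag_perm (Suc t)))"
      using main(2) by (simp add: flag_perm_def)
    also have "\<dots> = N $$ (0, 1) * N $$ (1, 2) * N $$ (2, 5) * N $$ (5, 4) * N $$ (4, 3)"
      by (simp add: eval_nat_numeral lessThan_Suc flag_perm_def mult_ac)
    finally show ?thesis using True by (simp add: corner_mat_def)
  next
    case False
    then have "flag_perm j < flag_perm i + 5" using ij by (auto simp: flag_perm_def split: if_splits)
    then show ?thesis using main(1) False ij by (auto simp: corner_mat_def)
  qed
qed (use N in auto)

lemma one_plus_minus_one_mat: "(B :: 'a :: comm_ring_1 mat) \<in> carrier_mat n n \<Longrightarrow> 1\<^sub>m n + B - 1\<^sub>m n = B"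
  by (intro eq_matI) auto

lemma unipotent_Sp_minus_one:
  assumes "A \<in> unipotent_Sp" "i < 6" "j \<le> i"
  shows "(A - 1\<^sub>m 6) $$ (flag_perm i, flag_perm j) = 0"
proof -
  have "A \<in> carrier_mat 6 6" using assms by (auto simp: unipotent_Sp_def borel_Sp_def Sp_3_carrier_mat)
  moreover have "flag_perm j = flag_perm i \<longleftrightarrow> i = j"
    using assms flag_perm_flag_perm by (metis le_less_trans)
  ultimately show ?thesis
    using assms by (auto simp: unipotent_Sp_def borel_Sp_def flag_perm_less)
qed

context card_5_field
begin

lemma unipotent_Sp_pow_5:
  assumes A: "(A :: 'a mat) \<in> unipotent_Sp"
  shows "A ^\<^sub>m 5 = 1\<^sub>m 6 + corner_mat (A $$ (0, 1) * A $$ (1, 2) * A $$ (2, 5) * A $$ (5, 4) * A $$ (4, 3))"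
proof -
  have cA: "A \<in> carrier_mat 6 6" using A by (auto simp: unipotent_Sp_def borel_Sp_def Sp_3_carrier_mat)
  have N: "A - 1\<^sub>m 6 \<in> carrier_mat 6 6" by (simp add: minus_carrier_mat)
  have "A = 1\<^sub>m 6 + (A - 1\<^sub>m 6)" using cA by auto
  then have "A ^\<^sub>m 5 = 1\<^sub>m 6 + (A - 1\<^sub>m 6) ^\<^sub>m 5" using frobenius_mat[OF N five_eq_0] by simp
  then show ?thesis
    using strict_flag_pow_5[OF N unipotent_Sp_minus_one[OF A]] cA by simp
qed

lemma corner_mat_pow_5: "(1\<^sub>m 6 + corner_mat (c :: 'a)) ^\<^sub>m 5 = 1\<^sub>m 6"
proof -
  have "corner_mat c ^\<^sub>m 5 = 0\<^sub>m 6 6"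
    by (subst strict_flag_pow_5) (auto simp: corner_mat_def flag_perm_def)
  then show ?thesis using frobenius_mat[OF corner_mat_carrier five_eq_0, of c] by auto
qed

lemma flag_roots_subset_pair_roots:
  assumes c: "(c :: 'a) \<noteq> 0"
  shows "flag_roots c \<subseteq> pair_roots c"
proof
  fix A :: "'a mat" assume A: "A \<in> flag_roots c"
  interpret A: transvection_root "TYPE('a)" A c
    by unfold_locales (use A c in \<open>auto simp: flag_roots_def carrier_Sp_3\<close>)
  have "A.N $$ (i, 2) = 0" if "i < 6" "i \<noteq> 0" for i
    using A A.A_index[OF that(1), of 2] that by (auto simp: flag_roots_def split: if_splits)
  note r = A.R_column_2_if[OF this]
  \<comment> \<open>Both coordinates x and y vanish here, so the factor in \<open>N'_pow_5\<close>
    is 1.\<close>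
  have "A.N' ^\<^sub>m 5 = A.N ^\<^sub>m 5"
    using A.N'_pow_5[OF r(1,2)] A.R_index_3_2(1)[OF r] r(3) by (auto simp: smult_mat_def map_mat_def intro!: eq_matI)
  then have "(A * (1\<^sub>m 6 - log_mat)) ^\<^sub>m 5 = 1\<^sub>m 6 + corner_mat c"
    unfolding A.mult_one_minus_log frobenius_mat[OF A.N'_carrier five_eq_0] by (simp add: A.N_pow_5)
  then show "A \<in> pair_roots c" using A by (simp add: pair_roots_def flag_roots_def)
qed

lemma pair_roots_2_subset_flag_roots: "pair_roots (2 :: 'a) \<subseteq> flag_roots 2"
proof
  fix A :: "'a mat" assume A: "A \<in> pair_roots 2"
  interpret A: transvection_root "TYPE('a)" A 2
    by unfold_locales (use A two_neq_0 in \<open>auto simp: pair_roots_def carrier_Sp_3\<close>)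
  have "A * (1\<^sub>m 6 - log_mat) \<in> carrier (Sp 3)"
    using A one_minus_log_mat_Sp by (intro mult_mem_Sp_3) (auto simp: pair_roots_def)
  \<comment> \<open>The second interpretation makes \<open>A.N'\<close> the nilpotent part of a
    root, hence similar to the shift matrix; this supplies the traces.\<close>
  then interpret B: transvection_root "TYPE('a)" "A * (1\<^sub>m 6 - log_mat)" 2
    by unfold_locales (use A two_neq_0 in \<open>auto simp: pair_roots_def carrier_Sp_3\<close>)
  have BN: "B.N = A.N'"
    unfolding B.N_def unfolding A.mult_one_minus_log by (rule one_plus_minus_one_mat[OF A.N'_carrier])
  note n = A.N_index_5_2[OF B.mat_tr_N_pow[of 1, unfolded BN] B.mat_tr_N_pow[of 2, unfolded BN]]
  have "((1 + A.R $$ (1, 4))\<^sup>2 * (1 - 2 * 2 * (A.R $$ (3, 2))\<^sup>2)) \<cdot>\<^sub>m corner_mat 2 = corner_mat (2 :: 'a)"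
    using A.N'_pow_5[OF n] B.N_pow_5 unfolding BN A.N_pow_5 by simp
  then have "(((1 + A.R $$ (1, 4))\<^sup>2 * (1 - 2 * 2 * (A.R $$ (3, 2))\<^sup>2)) \<cdot>\<^sub>m corner_mat 2) $$ (0, 3) = corner_mat (2 :: 'a) $$ (0, 3)"
    by (rule arg_cong)
  then have "((1 + A.R $$ (1, 4))\<^sup>2 * (1 - 2 * 2 * (A.R $$ (3, 2))\<^sup>2)) * 2 = (2 :: 'a)"
    by (simp add: corner_mat_def)
  then have "(1 + A.R $$ (1, 4))\<^sup>2 * (1 - 2 * 2 * (A.R $$ (3, 2))\<^sup>2) = 1"
    using two_neq_0 by simp
  then have "A.R $$ (3, 2) = 0" by (rule square_product_eq_1)
  from A.R_index_3_2(2)[OF n this] show "A \<in> flag_roots 2"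
    using A by (auto simp: pair_roots_def flag_roots_def A.A_index)
qed

end

text \<open>A regular unipotent matrix with superdiagonal -1, 1, 1, -1, 1 along the flag.
  Multiplication by u^-1 changes it to -2, 1, -1, -1, 2, and the products 1 and -4 agree modulo 5.
  The nonzero entry at (1, 2) keeps it out of the flag roots. The same matrix later detects the
  Borel subgroup.\<close>

definition regular_mat :: "'a :: comm_ring_1 mat" where
  "regular_mat = mat_of_rows_list 6
    [[1, - 1, 0, 0, 0, 0], [0, 1, 1, 0, 0, 1], [0, 0, 1, 0, 0, 1],
     [0, 0, 0, 1, 0, 0], [0, 0, 0, 1, 1, 0], [0, 0, 0, - 1, - 1, 1]]"

lemma regular_mat_carrier: "regular_mat \<in> carrier_mat 6 6"
  by (rule carrier_matI) (simp_all add: regular_mat_def mat_of_rows_list_def)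

lemma regular_mat_Sp: "regular_mat \<in> carrier (Sp 3)"
  unfolding sp_3_iff[OF regular_mat_carrier] all_less_6 by (simp add: regular_mat_def mat_of_rows_list_def)

lemma all_less_flag: "(\<forall>i<6. \<forall>j<i. Q i j) \<longleftrightarrow> Q 1 0 \<and> Q 2 0 \<and> Q 2 1 \<and> Q 3 0 \<and> Q 3 1 \<and> Q 3 2
  \<and> Q 4 0 \<and> Q 4 1 \<and> Q 4 2 \<and> Q 4 3 \<and> Q 5 0 \<and> Q 5 1 \<and> Q 5 2 \<and> Q 5 3 \<and> Q 5 (4::nat)"
  by (simp add: all_less_6) (auto simp: less_Suc_eq numeral_eq_Suc)

lemma regular_mat_unipotent: "regular_mat \<in> unipotent_Sp"
  unfolding unipotent_Sp_def borel_Sp_def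
  using regular_mat_Sp
  by (auto simp: all_less_flag all_less_6) (simp_all add: regular_mat_def mat_of_rows_list_def flag_perm_def)

section \<open>The unitriangular subgroup\<close>

lemma Sp_3_simps [simp]:
  "A \<otimes>\<^bsub>Sp 3\<^esub> B = A * B" "\<one>\<^bsub>Sp 3\<^esub> = 1\<^sub>m 6"
  by (simp_all add: Sp_def)

lemma Sp_3_pow [simp]:
  "A [^]\<^bsub>Sp 3\<^esub> (k :: nat) = A ^\<^sub>m k" if "A \<in> carrier (Sp 3 :: 'a :: field mat monoid)"
  using Sp_3_carrier_mat[OF that]
  by (induction k) (auto simp: monoid.nat_pow_0[OF group.is_monoid[OF group_Sp]] monoid.nat_pow_Suc[OF group.is_monoid[OF group_Sp]])

lemma upper_mult_index:
  assumes A: "A \<in> carrier_mat 6 6" and B: "B \<in> carrier_mat 6 6"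
    and upA: "\<forall>i<6. \<forall>j<i. A $$ (flag_perm i, flag_perm j) = 0"
    and upB: "\<forall>i<6. \<forall>j<i. B $$ (flag_perm i, flag_perm j) = 0"
    and ij: "i < 6" "j \<le> i"
  shows "(A * B) $$ (flag_perm i, flag_perm j)
     = (if i = j then A $$ (flag_perm i, flag_perm i) * B $$ (flag_perm i, flag_perm i) else 0)"
proof -
  have j: "j < 6" using ij by simp
  have "(A * B) $$ (flag_perm i, flag_perm j) = (\<Sum>k<6. A $$ (flag_perm i, flag_perm k) * B $$ (flag_perm k, flag_perm j))"
    unfolding index_mult_mat_sum[OF A B flag_perm_less[OF ij(1)] flag_perm_less[OF j]]
    by (rule sum.reindex_bij_betw[OF bij_betw_flag_perm, symmetric])
  also have "\<dots> = (\<Sum>k<6. if k = i \<and> i = j then A $$ (flag_perm i, flag_perm i) * B $$ (flag_perm i, flag_perm i) else 0)"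
  proof (rule sum.cong[OF refl])
    fix k :: nat assume "k \<in> {..<6}"
    then consider "k < i" | "k = i" "j = i" | "j < k" using ij by fastforce
    then show "A $$ (flag_perm i, flag_perm k) * B $$ (flag_perm k, flag_perm j) =
       (if k = i \<and> i = j then A $$ (flag_perm i, flag_perm i) * B $$ (flag_perm i, flag_perm i) else 0)"
      using upA upB ij \<open>k \<in> {..<6}\<close> by cases auto
  qed
  finally show ?thesis using ij by auto
qed

lemma borel_Sp_mult: "A \<in> borel_Sp \<Longrightarrow> B \<in> borel_Sp \<Longrightarrow> A * B \<in> borel_Sp"
  by (simp add: borel_Sp_def mult_mem_Sp_3 upper_mult_index Sp_3_carrier_mat)

lemma borel_Sp_mult_diag:
  assumes "A \<in> borel_Sp" "B \<in> borel_Sp" "i < 6"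
  shows "(A * B) $$ (i, i) = A $$ (i, i) * B $$ (i, i)"
  using assms upper_mult_index[of A B "flag_perm i" "flag_perm i"]
  by (simp add: borel_Sp_def Sp_3_carrier_mat flag_perm_less flag_perm_flag_perm)

lemma one_mem_borel_Sp: "1\<^sub>m 6 \<in> borel_Sp"
proof -
  have "1\<^sub>m 6 \<in> carrier (Sp 3 :: 'a :: field mat monoid)"
    using monoid.one_closed[OF group.is_monoid[OF group_Sp[of 3, where ?'a = 'a]]] by simp
  then show ?thesis by (auto simp: borel_Sp_def flag_perm_def)
qed

lemma borel_Sp_pow:
  assumes "A \<in> borel_Sp"
  shows "A ^\<^sub>m k \<in> borel_Sp" "i < 6 \<Longrightarrow> (A ^\<^sub>m k) $$ (i, i) = A $$ (i, i) ^ k"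
proof -
  have "A \<in> carrier_mat 6 6" using assms by (simp add: borel_Sp_def Sp_3_carrier_mat)
  then show *: "A ^\<^sub>m k \<in> borel_Sp" for k
    using assms by (induction k) (auto simp: one_mem_borel_Sp borel_Sp_mult)
  show "(A ^\<^sub>m k) $$ (i, i) = A $$ (i, i) ^ k" if "i < 6"
    using \<open>A \<in> carrier_mat 6 6\<close> that by (induction k) (auto simp: borel_Sp_mult_diag[OF * assms] simp del: index_mult_mat(1))
qed

lemma (in group) finite_subgroupI:
  assumes fin: "finite (carrier G)" and sub: "H \<subseteq> carrier G" and one: "\<one> \<in> H"
    and mult: "\<And>a b. a \<in> H \<Longrightarrow> b \<in> H \<Longrightarrow> a \<otimes> b \<in> H"
  shows "subgroup H G"
proof (rule subgroupI[OF sub])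
  fix a assume a: "a \<in> H"
  then have aG: "a \<in> carrier G" using sub by blast
  have pow: "a [^] (n :: nat) \<in> H" for n by (induction n) (simp_all add: one mult a)
  have "Coset.order G = Suc (Coset.order G - 1)" using order_gt_0_iff_finite fin by simp
  then have "a [^] (Coset.order G - 1) \<otimes> a = \<one>"
    using pow_order_eq_1[OF aG] by (metis nat_pow_Suc)
  then have "inv a = a [^] (Coset.order G - 1)" using aG by (metis inv_equality nat_pow_closed)
  then show "inv a \<in> H" using pow by simp
qed (use one mult in auto)

lemma (in group) coprime_2_ord:
  assumes "g \<in> carrier G" "g [^] (5::nat) = \<one>"
  shows "coprime 2 (ord g)"
proof -
  have "ord g dvd 5" using assms by (simp add: pow_eq_id)
  then have "odd (ord g)" by (metis dvd_trans odd_numeral)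
  then show ?thesis by simp
qed

context card_5_field
begin

sublocale Sp3: group "Sp 3 :: 'a mat monoid"
  by (rule group_Sp)

lemma finite_Sp: "finite (carrier (Sp 3 :: 'a mat monoid))"
  using finite_carrier_mat[OF finite_field, of 6 6] by (rule finite_subset[rotated]) (auto simp: Sp_3_carrier_mat)

lemma subgroup_borel_Sp: "subgroup (borel_Sp :: 'a mat set) (Sp 3)"
  by (rule Sp3.finite_subgroupI[OF finite_Sp]) (simp_all add: borel_Sp_mult one_mem_borel_Sp, simp add: borel_Sp_def)

lemma subgroup_unipotent_Sp: "subgroup (unipotent_Sp :: 'a mat set) (Sp 3)"
proof (rule Sp3.finite_subgroupI[OF finite_Sp])
  show "unipotent_Sp \<subseteq> carrier (Sp 3 :: 'a mat monoid)" by (auto simp: unipotent_Sp_def borel_Sp_def)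
qed (auto simp: unipotent_Sp_def borel_Sp_mult one_mem_borel_Sp borel_Sp_mult_diag simp del: index_mult_mat(1))

lemma inv_one_plus_log_mat: "inv\<^bsub>Sp 3\<^esub> (1\<^sub>m 6 + log_mat) = (1\<^sub>m 6 - log_mat :: 'a mat)"
proof (rule Sp3.inv_equality)
  show "(1\<^sub>m 6 - log_mat) \<otimes>\<^bsub>Sp 3\<^esub> (1\<^sub>m 6 + log_mat) = (\<one>\<^bsub>Sp 3\<^esub> :: 'a mat)"
    using mat_mult_left_right_inverse[OF one_minus_log_mat(2,1) log_mat_inverse] by simp
qed (simp_all add: one_minus_log_mat_Sp one_plus_log_mat_Sp)

lemma one_plus_corner_mat_square:
  "(1\<^sub>m 6 + corner_mat 1) ^\<^sub>m 2 = (1\<^sub>m 6 + corner_mat 2 :: 'a mat)"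
proof -
  let ?E = "corner_mat 1 :: 'a mat"
  have "(1\<^sub>m 6 + ?E) ^\<^sub>m 2 = (1\<^sub>m 6 + ?E) + (1\<^sub>m 6 + ?E) * ?E"
    by (simp add: numeral_2_eq_2 mult_add_distrib_mat[of _ 6 6 _ 6] left_mult_one_mat[of _ 6 6] right_mult_one_mat[of _ 6 6])
  also have "\<dots> = 1\<^sub>m 6 + corner_mat 2"
    by (rule eq_matI) (auto simp: mult_corner_mat_index[of "1\<^sub>m 6 + ?E"] simp del: index_mult_mat(1), auto simp: corner_mat_def)
  finally show ?thesis .
qed

lemma log_mat_corner_mat_commute:
  "(1\<^sub>m 6 + log_mat) * (1\<^sub>m 6 + corner_mat c) = (1\<^sub>m 6 + corner_mat c) * (1\<^sub>m 6 + log_mat :: 'a mat)"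
proof -
  have "log_mat * corner_mat c = 0\<^sub>m 6 6" "corner_mat c * log_mat = (0\<^sub>m 6 6 :: 'a mat)"
    by (rule eq_matI; auto simp: mult_corner_mat_index[OF log_mat_carrier] simp del: index_mult_mat(1); auto simp: log_mat_def)+
  then show ?thesis
    by (simp add: mult_add_distrib_mat[of _ 6 6 _ 6] add_mult_distrib_mat[of _ 6 6 _ _ 6]
       left_mult_one_mat[of _ 6 6] right_mult_one_mat[of _ 6 6]) (auto intro!: eq_matI)
qed

lemma regular_mat_pair_root: "regular_mat \<in> pair_roots (1 :: 'a)"
proof -
  let ?A = "regular_mat :: 'a mat"
  note r = regular_mat_def mat_of_rows_list_def
  have "?A ^\<^sub>m 5 = 1\<^sub>m 6 + corner_mat 1"
    unfolding unipotent_Sp_pow_5[OF regular_mat_unipotent] by (simp add: r)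
  moreover have "(?A * (1\<^sub>m 6 - log_mat)) ^\<^sub>m 5 = 1\<^sub>m 6 + corner_mat 1"
  proof -
    let ?V = "1\<^sub>m 6 - log_mat :: 'a mat"
    have "?V \<in> unipotent_Sp"
      using one_minus_log_mat_Sp unfolding unipotent_Sp_def borel_Sp_def
      by (auto simp: all_less_flag all_less_6) (simp_all add: log_mat_def flag_perm_def)
    then have U: "?A * ?V \<in> unipotent_Sp"
      using regular_mat_unipotent subgroup.m_closed[OF subgroup_unipotent_Sp] by fastforce
    have i: "(?A * ?V) $$ (i, j) = ?A $$ (i, j) - (if j = 1 then ?A $$ (i, 0) else if j = 3 then - ?A $$ (i, 4)
       else if j = 5 then 2 * ?A $$ (i, 2) else 0)" if "i < 6" "j < 6" for i j
    proof -
      have "?A * ?V = ?A - ?A * log_mat"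
        using regular_mat_carrier[where ?'a = 'a] by (simp add: mult_minus_distrib_mat[of _ 6 6 _ 6] right_mult_one_mat[of _ 6 6])
      moreover have "(?A - ?A * log_mat) $$ (i, j) = ?A $$ (i, j) - (?A * log_mat) $$ (i, j)"
        using that mult_carrier_mat[OF regular_mat_carrier[where ?'a = 'a] log_mat_carrier]
        by (intro index_minus_mat(1)) auto
      ultimately show ?thesis
        using mult_log_mat_index[OF regular_mat_carrier[where ?'a = 'a] that] by (simp only:)
    qed
    have "(- 4 :: 'a) = 1 - 5" by simp
    also have "\<dots> = 1" unfolding five_eq_0 by simp
    finally have four: "(- 4 :: 'a) = 1" .
    show ?thesis
      unfolding unipotent_Sp_pow_5[OF U] by (simp add: i del: index_mult_mat(1)) (simp add: r four)
  qed
  ultimately show ?thesis using regular_mat_Sp by (simp add: pair_roots_def)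
qed

lemma regular_mat_not_flag_root: "regular_mat \<notin> flag_roots (1 :: 'a)"
  by (auto simp: flag_roots_def regular_mat_def mat_of_rows_list_def intro!: exI[of _ 1])

text \<open>For c = 2 every solution is a flag root, so its entry (1, 2) is 0; in a unitriangular
  matrix this entry is a factor of the corner of the fifth power.\<close>

lemma pair_roots_2_unipotent: "pair_roots 2 \<inter> unipotent_Sp = ({} :: 'a mat set)"
proof -
  have False if A: "A \<in> pair_roots 2" "A \<in> unipotent_Sp" for A :: "'a mat"
  proof -
    have "A \<in> flag_roots 2" using A pair_roots_2_subset_flag_roots by blast
    then have "A $$ (1, 2) = 0" by (simp add: flag_roots_def)
    then have "A ^\<^sub>m 5 = 1\<^sub>m 6 + corner_mat 0" using unipotent_Sp_pow_5[OF A(2)] by simp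
    then have "(1\<^sub>m 6 + corner_mat (0 :: 'a)) $$ (0, 3) = (1\<^sub>m 6 + corner_mat 2) $$ (0, 3)"
      using A(1) by (simp add: pair_roots_def)
    then show False using two_neq_0 by (simp add: corner_mat_def)
  qed
  then show ?thesis by blast
qed

lemma finite_pair_roots: "finite (pair_roots c :: 'a mat set)"
  using finite_Sp by (rule finite_subset[rotated]) (auto simp: pair_roots_def)

lemma card_pair_roots: "card (pair_roots (2 :: 'a)) < card (pair_roots (1 :: 'a))"
proof -
  \<comment> \<open>Conjugation by \<open>half_diag 3\<close>, whose inverse is
    \<open>half_diag 2\<close>, multiplies the corner entry by 2 and so carries c = 1 to c =
    2.\<close>
  have six: "(3 :: 'a) * 2 = 1"
  proof -
    have "(3 :: 'a) * 2 = 5 + 1" by simp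
    then show ?thesis using five_eq_0 by simp
  qed
  have "pair_roots 2 = flag_roots (2 :: 'a)"
    using pair_roots_2_subset_flag_roots flag_roots_subset_pair_roots[OF two_neq_0] by blast
  then have "card (pair_roots (2 :: 'a)) = card (flag_roots (1 :: 'a))"
    using card_flag_roots[OF six, of 1] by simp
  also have "\<dots> < card (pair_roots (1 :: 'a))"
    using flag_roots_subset_pair_roots[of "1 :: 'a"] regular_mat_pair_root regular_mat_not_flag_root
    by (intro psubset_card_mono finite_pair_roots) auto
  finally show ?thesis .
qed

text \<open>The solution sets are the intersections of \<open>pair_roots\<close> with the
  unitriangular group: nonempty for c = 1 because of \<open>regular_mat\<close>, empty for c =
  2.\<close>

lemma not_FSZ_unipotent_Sp: "\<not> FSZ 5 ((Sp 3 :: 'a mat monoid)\<lparr>carrier := unipotent_Sp\<rparr>)"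
proof
  let ?Q = "(Sp 3 :: 'a mat monoid)\<lparr>carrier := unipotent_Sp\<rparr>"
  let ?g = "\<lambda>c. 1\<^sub>m 6 + corner_mat c :: 'a mat" and ?u = "1\<^sub>m 6 + log_mat :: 'a mat"
  assume FSZ: "FSZ 5 ?Q"
  interpret Q: group ?Q using subgroup_unipotent_Sp by (rule Sp3.subgroup_imp_group)
  have carr: "A \<in> carrier (Sp 3)" if "A \<in> unipotent_Sp" for A :: "'a mat"
    using that by (simp add: unipotent_Sp_def borel_Sp_def)
  have g: "?g c \<in> unipotent_Sp" for c
    using one_plus_corner_mat_Sp[of c]
    by (auto simp: unipotent_Sp_def borel_Sp_def all_less_flag all_less_6 corner_mat_def flag_perm_def)
  have u: "?u \<in> unipotent_Sp"
    using one_plus_log_mat_Sp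
    by (auto simp: unipotent_Sp_def borel_Sp_def all_less_flag all_less_6 log_mat_def flag_perm_def)
  have pow: "A [^]\<^bsub>?Q\<^esub> (n :: nat) = A ^\<^sub>m n" if "A \<in> unipotent_Sp" for A n
    using carr[OF that] by (metis Sp3.nat_pow_consistent Sp_3_pow)
  have invu: "inv\<^bsub>?Q\<^esub> ?u = 1\<^sub>m 6 - log_mat"
    using Sp3.m_inv_consistent[OF subgroup_unipotent_Sp u] inv_one_plus_log_mat by simp
  have mem: "A * (1\<^sub>m 6 - log_mat) \<in> unipotent_Sp" if "A \<in> unipotent_Sp" for A :: "'a mat"
    using Q.m_closed[of A "inv\<^bsub>?Q\<^esub> ?u"] Q.inv_closed[of ?u] that u by (simp add: invu)
  have set: "FSZ_set ?Q 5 ?u (?g c) = pair_roots c \<inter> unipotent_Sp" for c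
    by (auto simp: FSZ_set_def pair_roots_def pow invu mem carr)
  have "?u \<in> centralizer ?Q (?g 1)"
    using u log_mat_corner_mat_commute by (simp add: centralizer_def)
  moreover have "coprime 2 (Q.ord (?g 1))"
    using g by (intro Q.coprime_2_ord) (auto simp: pow corner_mat_pow_5)
  ultimately have "card (FSZ_set ?Q 5 ?u (?g 1)) = card (FSZ_set ?Q 5 ?u (?g 1 [^]\<^bsub>?Q\<^esub> (2::nat)))"
    using FSZ g unfolding FSZ_def by auto
  then have "card (pair_roots 1 \<inter> unipotent_Sp :: 'a mat set) = 0"
    by (simp only: pow[OF g] one_plus_corner_mat_square set pair_roots_2_unipotent card.empty)
  then show False
    using regular_mat_pair_root regular_mat_unipotent finite_pair_roots by (auto simp: card_eq_0_iff)
qed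

end

section \<open>The projective symplectic group\<close>

text \<open>For symmetric \<open>s\<close> these matrices form the unipotent radical of the Siegel
  parabolic subgroup; they serve as test elements for the center.\<close>

definition siegel_mat :: "(nat \<Rightarrow> nat \<Rightarrow> 'a :: comm_ring_1) \<Rightarrow> 'a mat" where
  "siegel_mat s = mat 6 6 (\<lambda>(i, j). if i = j then 1 else if i < 3 \<and> j \<ge> 3 then s i (j - 3) else 0)"

lemma siegel_mat_carrier: "siegel_mat s \<in> carrier_mat 6 6"
  by (simp add: siegel_mat_def)

lemma siegel_mat_Sp:
  assumes "s 0 1 = s 1 0" "s 0 2 = s 2 0" "s 1 2 = s 2 1"
  shows "siegel_mat s \<in> carrier (Sp 3)"
  unfolding sp_3_iff[OF siegel_mat_carrier] all_less_6 using assms by (simp add: siegel_mat_def)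

lemma sp_form_3_Sp: "sp_form 3 \<in> carrier (Sp 3)"
  unfolding sp_3_iff[OF sp_form_3_carrier] all_less_6 by (simp add: sp_form_3_index)

text \<open>Commuting with the elementary Siegel matrices clears the first three columns off the
  diagonal and links diagonal entries; commuting with the matrix of the form carries this over to
  the other columns. What remains is a scalar, and preserving the form makes its square 1.\<close>

lemma center_Sp_3: "center (Sp 3 :: 'a :: field mat monoid) = {1\<^sub>m 6, - 1\<^sub>m 6}"
proof
  let ?J = "sp_form 3 :: 'a mat"
  show "center (Sp 3 :: 'a mat monoid) \<subseteq> {1\<^sub>m 6, - 1\<^sub>m 6}"
  proof
    fix z :: "'a mat" assume z: "z \<in> center (Sp 3)"
    then have comm: "z * B = B * z" if "B \<in> carrier (Sp 3)" for B
      using that by (auto simp: center_def)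
    have zS: "z \<in> carrier (Sp 3)" using z by (simp add: center_def)
    have cz: "z \<in> carrier_mat 6 6" using zS by (rule Sp_3_carrier_mat)
    have J: "(if j < 3 then - z $$ (i, j + 3) else z $$ (i, j - 3)) = (if i < 3 then z $$ (i + 3, j) else - z $$ (i - 3, j))"
      if ij: "i < 6" "j < 6" for i j
    proof -
      have "(z * ?J) $$ (i, j) = (?J * z) $$ (i, j)" using comm[OF sp_form_3_Sp] by simp
      moreover have "(?J * z) $$ (i, j) = (if i < 3 then z $$ (i + 3, j) else - z $$ (i - 3, j))"
        using less_6_cases[OF ij(1)] cz ij
        by (auto simp: index_mult_mat_sum[of _ 6 6 _ 6] sum_lessThan_6 sp_form_3_index simp del: index_mult_mat(1))
      ultimately show ?thesis using mult_sp_form_3_index[OF cz ij] by simp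
    qed
    have S: "(\<Sum>k<6. z $$ (i, k) * siegel_mat s $$ (k, j)) = (\<Sum>k<6. siegel_mat s $$ (i, k) * z $$ (k, j))"
      if "s 0 1 = s 1 0" "s 0 2 = s 2 0" "s 1 2 = s 2 1" "i < 6" "j < 6" for s i j
      using index_mult_mat_sum[OF cz siegel_mat_carrier that(4,5), of s]
        index_mult_mat_sum[OF siegel_mat_carrier cz that(4,5), of s] comm[OF siegel_mat_Sp[OF that(1-3)]] by simp
    let ?s = "\<lambda>a b i j. if i = a \<and> j = b \<or> i = b \<and> j = a then 1 else 0 :: 'a"
    have left: "z $$ (i, a) = 0" if "i < 6" "a < 3" "i \<noteq> a" for i a
    proof -
      have "a = 0 \<or> a = 1 \<or> a = 2" using that by auto
      then show ?thesis
        using S[of "?s a a" i "a + 3"] that less_6_cases[OF that(1)]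
        by (elim disjE) (simp_all add: sum_lessThan_6 siegel_mat_def)
    qed
    have diag: "z $$ (4, 4) = z $$ (0, 0)" "z $$ (5, 5) = z $$ (1, 1)"
      using S[of "?s 0 1" 0 4] S[of "?s 1 2" 1 5] left by (simp_all add: sum_lessThan_6 siegel_mat_def)
    have shift: "z $$ (i + 3, j + 3) = z $$ (i, j)" if "i < 3" "j < 3" for i j
      using J[of i "j + 3"] that by simp
    have right: "z $$ (i, j + 3) = 0" if "i < 3" "j < 3" for i j
      using J[of "i" "j"] left[of "i + 3" j] that by simp
    have d: "z $$ (i, i) = z $$ (0, 0)" if "i < 3" for i
    proof -
      have "z $$ (4, 4) = z $$ (1, 1)" "z $$ (5, 5) = z $$ (2, 2)"
        using shift[of 1 1] shift[of 2 2] by simp_all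
      moreover have "i = 0 \<or> i = 1 \<or> i = 2" using that by auto
      ultimately show ?thesis using diag by metis
    qed
    have scalar: "z $$ (i, j) = (if i = j then z $$ (0, 0) else 0)" if "i < 6" "j < 6" for i j
    proof (cases "j < 3")
      case True
      then show ?thesis using left[of i j] d[of j] that by simp
    next
      case False
      then have j: "j = (j - 3) + 3" "j - 3 < 3" using that by auto
      define j' where "j' = j - 3"
      have j: "j = j' + 3" "j' < 3" using j by (simp_all add: j'_def)
      show ?thesis
      proof (cases "i < 3")
        case True
        then show ?thesis using right[of i j'] j by simp
      next
        case False
        then have i: "i = (i - 3) + 3" "i - 3 < 3" using that by auto
        define i' where "i' = i - 3"
        have "i = i' + 3" "i' < 3" using i by (simp_all add: i'_def)
        then show ?thesis using shift[of i' j'] left[of i' j'] d[of j'] j by simp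
      qed
    qed
    define l where "l = z $$ (0, 0)"
    note scalar = scalar[folded l_def]
    have "l * l = 1"
    proof -
      have "\<forall>i<6. \<forall>j<6. z $$ (0, i) * z $$ (3, j) + z $$ (1, i) * z $$ (4, j) + z $$ (2, i) * z $$ (5, j)
          - z $$ (3, i) * z $$ (0, j) - z $$ (4, i) * z $$ (1, j) - z $$ (5, i) * z $$ (2, j)
          = (if j = i + 3 then 1 else if i = j + 3 then - 1 else 0)"
        using zS by (simp add: sp_3_iff[OF cz])
      from this[rule_format, of 0 3] show ?thesis by (simp add: scalar)
    qed
    then have "l = 1 \<or> l = - 1" by (simp add: square_eq_1_iff)
    then show "z \<in> {1\<^sub>m 6, - 1\<^sub>m 6}"
    proof
      assume "l = 1"
      then have "z = 1\<^sub>m 6" using cz by (intro eq_matI) (auto simp: scalar)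
      then show ?thesis by simp
    next
      assume "l = - 1"
      then have "z = - 1\<^sub>m 6" using cz by (intro eq_matI) (auto simp: scalar)
      then show ?thesis by simp
    qed
  qed
  have "- 1\<^sub>m 6 \<in> carrier_mat 6 6" by simp
  then have "- 1\<^sub>m 6 \<in> carrier (Sp 3 :: 'a mat monoid)" by (simp add: sp_3_iff all_less_6)
  moreover have "- 1\<^sub>m 6 * A = A * - 1\<^sub>m 6" if "A \<in> carrier (Sp 3)" for A :: "'a mat"
  proof -
    have A: "A \<in> carrier_mat 6 6" using that by (rule Sp_3_carrier_mat)
    have "- 1\<^sub>m 6 * A = - (1\<^sub>m 6 * A)" using A by (intro uminus_mult_left_mat) auto
    moreover have "A * - 1\<^sub>m 6 = - (A * 1\<^sub>m 6)" using A by (intro uminus_mult_right_mat) auto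
    ultimately show ?thesis using A by simp
  qed
  moreover have "1\<^sub>m 6 \<in> carrier (Sp 3 :: 'a mat monoid)" 
    using one_mem_borel_Sp[where ?'a = 'a] by (simp add: borel_Sp_def)
  ultimately show "{1\<^sub>m 6, - 1\<^sub>m 6} \<subseteq> center (Sp 3 :: 'a mat monoid)"
    by (auto simp: center_def dest: Sp_3_carrier_mat)
qed

text \<open>A strictly triangular matrix with nonzero superdiagonal preserves only one full flag.
  Once the columns before \<open>j\<close> are settled, \<open>x b\<close>, and hence
  \<open>a x\<close>, vanishes in column \<open>j\<close> from row \<open>j\<close> on. Inside a
  column the induction runs upwards from the last row: row \<open>i - 1\<close> of
  \<open>a x\<close> then has the single term \<open>a (i - 1) i * x i j\<close>.\<close>

lemma intertwiner_upper:
  fixes a b x :: "nat \<Rightarrow> nat \<Rightarrow> 'a :: field"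
  assumes a: "\<And>i j. i < n \<Longrightarrow> j \<le> i \<Longrightarrow> a i j = 0" and b: "\<And>i j. i < n \<Longrightarrow> j \<le> i \<Longrightarrow> b i j = 0"
    and super: "\<And>i. Suc i < n \<Longrightarrow> a i (Suc i) \<noteq> 0"
    and eq: "\<And>i j. i < n \<Longrightarrow> j < n \<Longrightarrow> (\<Sum>k<n. a i k * x k j) = (\<Sum>k<n. x i k * b k j)"
    and ij: "i < n" "j < i"
  shows "x i j = 0"
  using ij
proof (induction j arbitrary: i rule: less_induct)
  case (less j)
  have zero: "(\<Sum>k<n. a r k * x k j) = 0" if "r < n" "j \<le> r" for r
  proof -
    have "x r k * b k j = 0" if "k < n" for k
      using less.IH[of k r] b[OF that, of j] \<open>r < n\<close> \<open>j \<le> r\<close> by (cases "j \<le> k") auto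
    then have "(\<Sum>k<n. x r k * b k j) = 0" by (intro sum.neutral) simp
    then show ?thesis using eq[of r j] that by simp
  qed
  show ?case
    using less.prems
  proof (induction "n - i" arbitrary: i rule: less_induct)
    case (less i)
    have i: "Suc (i - 1) = i" using less.prems by simp
    have "a (i - 1) k * x k j = 0" if "k < n" "k \<noteq> i" for k
    proof (cases "k < i")
      case True
      then show ?thesis using a[of "i - 1" k] less.prems by simp
    next
      case False
      then show ?thesis using less.hyps[of k] that less.prems by simp
    qed
    then have "(\<Sum>k<n. a (i - 1) k * x k j) = (\<Sum>k\<in>{i}. a (i - 1) k * x k j)"
      using less.prems by (intro sum.mono_neutral_right) auto
    then have "a (i - 1) i * x i j = 0" using zero[of "i - 1"] less.prems by simp
    then show ?case using super[of "i - 1"] less.prems i by simp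
  qed
qed

section \<open>Passage to the quotient by the center\<close>

context card_5_field
begin

definition proj :: "'a mat \<Rightarrow> 'a mat set" where
  "proj A = center (Sp 3) #>\<^bsub>Sp 3\<^esub> A"

sublocale PSp3: group "PSp 3 :: 'a mat set monoid"
  by (rule group_PSp)

lemma neg_mem_Sp: "A \<in> carrier (Sp 3) \<Longrightarrow> - A \<in> carrier (Sp 3 :: 'a mat monoid)"
proof -
  assume A: "A \<in> carrier (Sp 3 :: 'a mat monoid)"
  have "- 1\<^sub>m 6 \<in> center (Sp 3 :: 'a mat monoid)" by (simp add: center_Sp_3)
  then have "- 1\<^sub>m 6 * A \<in> carrier (Sp 3)" using A by (intro mult_mem_Sp_3) (auto simp: center_def)
  moreover have "- 1\<^sub>m 6 * A = - A" using Sp_3_carrier_mat[OF A] by (subst uminus_mult_left_mat) auto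
  ultimately show ?thesis by simp
qed

lemma proj_eq:
  assumes "A \<in> carrier (Sp 3)"
  shows "proj A = {A, - A}"
proof -
  have "- 1\<^sub>m 6 * A = - A" "1\<^sub>m 6 * A = A" using Sp_3_carrier_mat[OF assms] by (auto simp: uminus_mult_left_mat)
  then show ?thesis by (auto simp: proj_def r_coset_def center_Sp_3)
qed

lemma proj_eq_iff:
  assumes "A \<in> carrier (Sp 3)" "B \<in> carrier (Sp 3)"
  shows "proj A = proj B \<longleftrightarrow> A = B \<or> A = - B"
proof -
  have "- (- A) = A" using assms by (intro uminus_uminus_mat)
  then show ?thesis unfolding proj_eq[OF assms(1)] proj_eq[OF assms(2)] by (auto simp: doubleton_eq_iff)
qed

sublocale proj: group_hom "Sp 3 :: 'a mat monoid" "PSp 3 :: 'a mat set monoid" proj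
proof -
  interpret N: normal "center (Sp 3 :: 'a mat monoid)" "Sp 3 :: 'a mat monoid"
    by (rule normal_center[OF group_Sp])
  have "proj \<in> hom (Sp 3) (PSp 3)"
    using N.r_coset_hom_Mod unfolding proj_def PSp_def .
  then show "group_hom (Sp 3 :: 'a mat monoid) (PSp 3) proj"
    by (simp add: group_hom_def group_hom_axioms_def group_Sp group_PSp)
qed

lemma proj_mult:
  "A \<in> carrier (Sp 3) \<Longrightarrow> B \<in> carrier (Sp 3) \<Longrightarrow> proj A \<otimes>\<^bsub>PSp 3\<^esub> proj B = proj (A * B)"
  using proj.hom_mult[of A B] by simp

lemma carrier_PSp: "carrier (PSp 3 :: 'a mat set monoid) = proj ` carrier (Sp 3)"
  by (auto simp: PSp_def FactGroup_def RCOSETS_def proj_def)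

lemma finite_PSp: "finite (carrier (PSp 3 :: 'a mat set monoid))"
  unfolding carrier_PSp using finite_Sp by simp

lemma neg_pow_5:
  assumes "A \<in> carrier_mat 6 6"
  shows "(- A) ^\<^sub>m 5 = - (A ^\<^sub>m 5 :: 'a mat)"
proof -
  have neg: "- B * - A = B * A" if "B \<in> carrier_mat 6 6" for B :: "'a mat"
    using that assms by (simp add: uminus_mult_left_mat uminus_mult_right_mat)
  have "- A * - A = A * A" using neg assms by blast
  then show ?thesis using assms
    by (simp add: numeral_eq_Suc uminus_mult_left_mat uminus_mult_right_mat mult_carrier_mat[of _ 6 6 _ 6])
qed

lemma one_neq_neg_one: "(1 :: 'a) \<noteq> - 1"
  using two_neq_0 by (simp add: eq_neg_iff_add_eq_0)

lemma one_plus_corner_mat_neq_neg: "1\<^sub>m 6 + corner_mat c \<noteq> - (1\<^sub>m 6 + corner_mat c :: 'a mat)"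
proof
  assume "1\<^sub>m 6 + corner_mat c = - (1\<^sub>m 6 + corner_mat c :: 'a mat)"
  then have "(1\<^sub>m 6 + corner_mat c) $$ (0, 0) = (- (1\<^sub>m 6 + corner_mat c :: 'a mat)) $$ (0, 0)" by simp
  then show False using one_neq_neg_one by (simp add: corner_mat_def)
qed

text \<open>As 5 is odd, the negative of a root of g is a root of -g, and g differs from -g.\<close>

lemma inj_on_proj_pair_roots: "inj_on proj (pair_roots c)"
proof (rule inj_onI)
  fix A B :: "'a mat" assume AB: "A \<in> pair_roots c" "B \<in> pair_roots c" "proj A = proj B"
  then have "A = B \<or> A = - B" by (subst (asm) proj_eq_iff) (auto simp: pair_roots_def)
  moreover have "A \<noteq> - B"
  proof
    assume "A = - B"
    then have "A ^\<^sub>m 5 = - (B ^\<^sub>m 5)"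
      using AB neg_pow_5[of B] by (auto simp: pair_roots_def Sp_3_carrier_mat)
    then show False using AB one_plus_corner_mat_neq_neg[of c] by (simp add: pair_roots_def)
  qed
  ultimately show "A = B" by blast
qed

lemma pow_index_0:
  assumes "(A :: 'a mat) \<in> carrier_mat 6 6" "\<And>i. i < 6 \<Longrightarrow> A $$ (i, 0) = (if i = 0 then 1 else 0)" "i < 6"
  shows "(A ^\<^sub>m k) $$ (i, 0) = (if i = 0 then 1 else 0)"
  using assms(3)
proof (induction k arbitrary: i)
  case (Suc k)
  then show ?case using assms(1,2)
    by (simp add: index_mult_mat_sum[of _ 6 6 _ 6] sum_lessThan_6 del: index_mult_mat(1))
qed (use assms(1) in simp)

text \<open>One of the two lifts of a solution has fifth power exactly g. For this lift
  \<open>A\<close> the power of A u^-1 is still known only up to sign; but \<open>A\<close> and u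
  fix e_0, so that power has entry 1 at (0, 0), whereas -g has -1 there.\<close>

lemma FSZ_set_PSp:
  assumes c: "c \<noteq> (0 :: 'a)"
  shows "FSZ_set (PSp 3) 5 (proj (1\<^sub>m 6 + log_mat)) (proj (1\<^sub>m 6 + corner_mat c)) = proj ` pair_roots c"
proof -
  let ?g = "1\<^sub>m 6 + corner_mat c :: 'a mat" and ?u = "1\<^sub>m 6 + log_mat :: 'a mat" and ?v = "1\<^sub>m 6 - log_mat :: 'a mat"
  have pow: "proj A [^]\<^bsub>PSp 3\<^esub> (5::nat) = proj (A ^\<^sub>m 5)" if "A \<in> carrier (Sp 3)" for A
    using proj.hom_nat_pow[OF that, of 5] that by simp
  have inv: "proj A \<otimes>\<^bsub>PSp 3\<^esub> inv\<^bsub>PSp 3\<^esub> proj ?u = proj (A * ?v)" if "A \<in> carrier (Sp 3)" for A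
    using proj.hom_inv[OF one_plus_log_mat_Sp] proj_mult[OF that one_minus_log_mat_Sp] by (simp add: inv_one_plus_log_mat)
  have Av: "A * ?v \<in> carrier (Sp 3)" if "A \<in> carrier (Sp 3)" for A :: "'a mat"
    using that one_minus_log_mat_Sp by (rule mult_mem_Sp_3)
  have powc: "A ^\<^sub>m k \<in> carrier (Sp 3)" if "A \<in> carrier (Sp 3)" for A :: "'a mat" and k
    using that Sp3.nat_pow_closed[OF that, of k] by simp
  show ?thesis
  proof
    show "proj ` pair_roots c \<subseteq> FSZ_set (PSp 3) 5 (proj ?u) (proj ?g)"
      by (auto simp: pair_roots_def FSZ_set_def pow inv Av)
    show "FSZ_set (PSp 3) 5 (proj ?u) (proj ?g) \<subseteq> proj ` pair_roots c"
    proof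
      fix a assume a: "a \<in> FSZ_set (PSp 3) 5 (proj ?u) (proj ?g)"
      then obtain A0 where A0: "A0 \<in> carrier (Sp 3)" "a = proj A0"
        by (auto simp: FSZ_set_def carrier_PSp)
      then have "proj (A0 ^\<^sub>m 5) = proj ?g" using a pow by (simp add: FSZ_set_def)
      then have A0g: "A0 ^\<^sub>m 5 = ?g \<or> A0 ^\<^sub>m 5 = - ?g"
        using A0 by (simp add: proj_eq_iff powc one_plus_corner_mat_Sp)
      obtain A where A: "A \<in> carrier (Sp 3)" "a = proj A" "A ^\<^sub>m 5 = ?g"
      proof (cases "A0 ^\<^sub>m 5 = ?g")
        case False
        then have "(- A0) ^\<^sub>m 5 = ?g"
          using A0g neg_pow_5[of A0] A0 by (simp add: Sp_3_carrier_mat)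
        moreover have "proj (- A0) = a"
          using A0 neg_mem_Sp by (simp add: proj_eq_iff)
        ultimately show thesis using that[of "- A0"] A0 neg_mem_Sp by blast
      qed (use A0 that in blast)
      have cA: "A \<in> carrier_mat 6 6" using A by (simp add: Sp_3_carrier_mat)
      interpret A: transvection_root ty A c
        by unfold_locales (use A c in \<open>auto simp: carrier_Sp_3\<close>)
      have "proj ((A * ?v) ^\<^sub>m 5) = proj ?g"
        using a A Av by (simp add: FSZ_set_def inv pow)
      then have "(A * ?v) ^\<^sub>m 5 = ?g \<or> (A * ?v) ^\<^sub>m 5 = - ?g"
        using A by (simp add: proj_eq_iff powc Av one_plus_corner_mat_Sp)
      moreover have "(A * ?v) ^\<^sub>m 5 \<noteq> - ?g"
      proof
        assume "(A * ?v) ^\<^sub>m 5 = - ?g"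
        then have "((A * ?v) ^\<^sub>m 5) $$ (0, 0) = (- ?g) $$ (0, 0)" by simp
        moreover have "(A * ?v) $$ (i, 0) = (if i = 0 then 1 else 0)" if "i < 6" for i
        proof -
          have "(1\<^sub>m 6 + A.N') $$ (i, 0) = 1\<^sub>m 6 $$ (i, 0) + A.N' $$ (i, 0)"
            using that A.N'_carrier by (intro index_add_mat(1)) auto
          then show ?thesis
            using that A.N'_index[OF that, of 0] A.N_index_0[OF that] by (simp add: A.mult_one_minus_log)
        qed
        ultimately show False
          using pow_index_0[OF Sp_3_carrier_mat[OF Av[OF A(1)]], of 0 5] one_neq_neg_one by (simp add: corner_mat_def)
      qed
      ultimately show "a \<in> proj ` pair_roots c" using A by (auto simp: pair_roots_def)
    qed
  qed
qed

lemma not_FSZ_PSp: "\<not> FSZ 5 (PSp 3 :: 'a mat set monoid)"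
proof
  let ?g = "\<lambda>c. 1\<^sub>m 6 + corner_mat c :: 'a mat" and ?u = "1\<^sub>m 6 + log_mat :: 'a mat"
  assume FSZ: "FSZ 5 (PSp 3 :: 'a mat set monoid)"
  have g: "proj (?g 1) \<in> carrier (PSp 3)" using one_plus_corner_mat_Sp by (intro proj.hom_closed)
  have pow: "proj (?g 1) [^]\<^bsub>PSp 3\<^esub> (n::nat) = proj (?g 1 ^\<^sub>m n)" for n
    using proj.hom_nat_pow[OF one_plus_corner_mat_Sp, of 1 n] by (simp add: one_plus_corner_mat_Sp)
  have "proj ?u \<in> centralizer (PSp 3) (proj (?g 1))"
    using log_mat_corner_mat_commute[of 1] one_plus_log_mat_Sp[where ?'a = 'a] one_plus_corner_mat_Sp[where ?'a = 'a]
    by (simp add: centralizer_def proj_mult)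
  moreover have "coprime 2 (PSp3.ord (proj (?g 1)))"
    using g pow[of 5] corner_mat_pow_5[of 1] proj.hom_one by (intro PSp3.coprime_2_ord) simp_all
  ultimately have "card (FSZ_set (PSp 3) 5 (proj ?u) (proj (?g 1))) = card (FSZ_set (PSp 3) 5 (proj ?u) (proj (?g 2)))"
    using FSZ g pow[of 2] unfolding FSZ_def one_plus_corner_mat_square by (metis pos2)
  then have "card (pair_roots (1 :: 'a)) = card (pair_roots (2 :: 'a))"
    by (simp add: FSZ_set_PSp two_neq_0 card_image inj_on_proj_pair_roots)
  then show False using card_pair_roots by simp
qed


section \<open>The Sylow 5-subgroups\<close>

lemma unipotent_Sp_pow_25:
  assumes "(A :: 'a mat) \<in> unipotent_Sp"
  shows "A ^\<^sub>m 25 = 1\<^sub>m 6"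
proof -
  have "A \<in> carrier_mat 6 6" using assms by (simp add: unipotent_Sp_def borel_Sp_def Sp_3_carrier_mat)
  then have "A ^\<^sub>m (5 * 5) = (A ^\<^sub>m 5) ^\<^sub>m 5" by (rule pow_mat_mult)
  then show ?thesis by (simp add: unipotent_Sp_pow_5[OF assms] corner_mat_pow_5)
qed

lemma card_unipotent_Sp: "\<exists>k. card (unipotent_Sp :: 'a mat set) = 5 ^ k"
proof -
  let ?Q = "(Sp 3 :: 'a mat monoid)\<lparr>carrier := unipotent_Sp\<rparr>"
  interpret Q: group ?Q using subgroup_unipotent_Sp by (rule Sp3.subgroup_imp_group)
  have sub: "unipotent_Sp \<subseteq> carrier (Sp 3 :: 'a mat monoid)" by (auto simp: unipotent_Sp_def borel_Sp_def)
  have "A [^]\<^bsub>?Q\<^esub> ((5::nat) ^ 2) = \<one>\<^bsub>?Q\<^esub>" if "A \<in> carrier ?Q" for A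
  proof -
    have A: "A \<in> unipotent_Sp" using that by simp
    have "A [^]\<^bsub>?Q\<^esub> (25::nat) = A [^]\<^bsub>Sp 3\<^esub> (25::nat)" by (rule Sp3.nat_pow_consistent[symmetric])
    also have "\<dots> = 1\<^sub>m 6" using A sub by (subst Sp_3_pow) (auto simp: unipotent_Sp_pow_25)
    finally show ?thesis by simp
  qed
  then show ?thesis
    using Q.card_eq_prime_power[of 5 2] finite_subset[OF sub finite_Sp] by simp
qed

text \<open>A regular unipotent element lies in only one conjugate of the Borel subgroup. Being
  conjugate to \<open>regular_mat\<close>, \<open>y\<close> satisfies y^25 = 1; its diagonal entries
  equal their own 25th powers and are therefore 1. So y - 1 is strictly triangular, as
  \<open>intertwiner_upper\<close> requires.\<close>

lemma regular_mat_conj_borel: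
  assumes x: "x \<in> carrier (Sp 3)" and y: "y \<in> borel_Sp" and eq: "regular_mat * x = x * (y :: 'a mat)"
  shows "x \<in> borel_Sp"
proof -
  let ?r = "regular_mat :: 'a mat"
  have yS: "y \<in> carrier (Sp 3)" using y by (simp add: borel_Sp_def)
  have cx: "x \<in> carrier_mat 6 6" and cy: "y \<in> carrier_mat 6 6" and cr: "?r \<in> carrier_mat 6 6"
    using x yS by (auto simp: Sp_3_carrier_mat regular_mat_carrier)
  have "?r ^\<^sub>m k * x = x * y ^\<^sub>m k" for k
  proof (induction k)
    case (Suc k)
    have "?r ^\<^sub>m Suc k * x = ?r ^\<^sub>m k * x * y"
      using cx cy cr eq by (simp add: assoc_mult_mat[of _ 6 6 _ 6 _ 6])
    also have "\<dots> = x * y ^\<^sub>m Suc k"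
      unfolding Suc.IH using cx cy by (simp add: assoc_mult_mat[of _ 6 6 _ 6 _ 6] pow_carrier_mat)
    finally show ?case .
  qed (use cx cy cr in simp)
  from this[of 25] have "x = x * y ^\<^sub>m 25"
    using unipotent_Sp_pow_25[OF regular_mat_unipotent] cx by simp
  then have "x \<otimes>\<^bsub>Sp 3\<^esub> y ^\<^sub>m 25 = x" by simp
  moreover have "y ^\<^sub>m 25 \<in> carrier (Sp 3)" using Sp3.nat_pow_closed[OF yS, of 25] yS by simp
  ultimately have y25: "y ^\<^sub>m 25 = 1\<^sub>m 6" using x Sp3.l_cancel_one'[of x "y ^\<^sub>m 25"] by auto
  have "y $$ (i, i) = 1" if "i < 6" for i
    using borel_Sp_pow(2)[OF y that, of 25] that power_power_5[of "y $$ (i, i)" 2] by (simp add: y25)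
  then have yU: "y \<in> unipotent_Sp" using y by (simp add: unipotent_Sp_def)
  let ?a = "\<lambda>i j. (?r - 1\<^sub>m 6) $$ (flag_perm i, flag_perm j)" and ?b = "\<lambda>i j. (y - 1\<^sub>m 6) $$ (flag_perm i, flag_perm j)"
  let ?x = "\<lambda>i j. x $$ (flag_perm i, flag_perm j)"
  have "?x i j = 0" if "i < 6" "j < i" for i j
  proof (rule intertwiner_upper[of 6 ?a ?b ?x, OF _ _ _ _ that])
    show "?a i j = 0" if "i < 6" "j \<le> i" for i j by (rule unipotent_Sp_minus_one[OF regular_mat_unipotent that])
    show "?b i j = 0" if "i < 6" "j \<le> i" for i j by (rule unipotent_Sp_minus_one[OF yU that])
    show "?a i (Suc i) \<noteq> 0" if "Suc i < 6" for i
    proof -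
      have "i = 0 \<or> i = 1 \<or> i = 2 \<or> i = 3 \<or> i = 4" using that by auto
      then show ?thesis by (elim disjE) (simp_all add: regular_mat_def mat_of_rows_list_def flag_perm_def)
    qed
    show "(\<Sum>k<6. ?a i k * ?x k j) = (\<Sum>k<6. ?x i k * ?b k j)" if "i < 6" "j < 6" for i j
    proof -
      have c: "?r - 1\<^sub>m 6 \<in> carrier_mat 6 6" "y - 1\<^sub>m 6 \<in> carrier_mat 6 6" by (simp_all add: minus_carrier_mat)
      have "(?r - 1\<^sub>m 6) * x = ?r * x - x" "x * (y - 1\<^sub>m 6) = x * y - x"
        using cx cy cr by (simp_all add: minus_mult_distrib_mat[of _ 6 6 _ _ 6] mult_minus_distrib_mat[of _ 6 6 _ 6])
      then have "(?r - 1\<^sub>m 6) * x = x * (y - 1\<^sub>m 6)" using eq by simp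
      then have "((?r - 1\<^sub>m 6) * x) $$ (flag_perm i, flag_perm j) = (x * (y - 1\<^sub>m 6)) $$ (flag_perm i, flag_perm j)" by simp
      then have "(\<Sum>k<6. (?r - 1\<^sub>m 6) $$ (flag_perm i, k) * x $$ (k, flag_perm j))
          = (\<Sum>k<6. x $$ (flag_perm i, k) * (y - 1\<^sub>m 6) $$ (k, flag_perm j))"
        unfolding index_mult_mat_sum[OF c(1) cx flag_perm_less[OF that(1)] flag_perm_less[OF that(2)]]
          index_mult_mat_sum[OF cx c(2) flag_perm_less[OF that(1)] flag_perm_less[OF that(2)]] .
      then show ?thesis
        unfolding sum.reindex_bij_betw[OF bij_betw_flag_perm, symmetric, of "\<lambda>k. (?r - 1\<^sub>m 6) $$ (flag_perm i, k) * x $$ (k, flag_perm j)"]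
          sum.reindex_bij_betw[OF bij_betw_flag_perm, symmetric, of "\<lambda>k. x $$ (flag_perm i, k) * (y - 1\<^sub>m 6) $$ (k, flag_perm j)"] .
    qed
  qed
  then show ?thesis using x by (simp add: borel_Sp_def)
qed

lemma neg_mem_borel: "A \<in> borel_Sp \<Longrightarrow> - A \<in> (borel_Sp :: 'a mat set)"
  by (auto simp: borel_Sp_def neg_mem_Sp flag_perm_less dest!: Sp_3_carrier_mat)

lemma inj_on_proj_unipotent: "inj_on proj unipotent_Sp"
proof (rule inj_onI)
  fix A B :: "'a mat" assume AB: "A \<in> unipotent_Sp" "B \<in> unipotent_Sp" "proj A = proj B"
  then have S: "A \<in> carrier (Sp 3)" "B \<in> carrier (Sp 3)" by (auto simp: unipotent_Sp_def borel_Sp_def)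
  have "A \<noteq> - B"
  proof
    assume "A = - B"
    then have "A $$ (0, 0) = (- B) $$ (0, 0)" by simp
    then show False using AB Sp_3_carrier_mat[OF S(2)] one_neq_neg_one by (simp add: unipotent_Sp_def)
  qed
  then show "A = B" using AB S by (simp add: proj_eq_iff)
qed

text \<open>Raising to the power 5^n does not change the diagonal of a Borel matrix over this field.
  For a lift \<open>A\<close> the diagonal is thus constantly 1 or constantly -1, and
  \<open>A\<close> or \<open>- A\<close> is unitriangular.\<close>

lemma proj_borel_pow_eq_one:
  assumes a: "a \<in> proj ` borel_Sp" and pow: "a [^]\<^bsub>PSp 3\<^esub> ((5::nat) ^ n) = \<one>\<^bsub>PSp 3\<^esub>"
  shows "a \<in> proj ` unipotent_Sp"
proof -
  obtain A where A: "A \<in> borel_Sp" "a = proj A" using a by blast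
  have AS: "A \<in> carrier (Sp 3)" using A by (simp add: borel_Sp_def)
  have cA: "A \<in> carrier_mat 6 6" using AS by (rule Sp_3_carrier_mat)
  have "A ^\<^sub>m (5 ^ n) \<in> carrier (Sp 3)" using borel_Sp_pow(1)[OF A(1)] by (simp add: borel_Sp_def)
  moreover have "1\<^sub>m 6 \<in> carrier (Sp 3 :: 'a mat monoid)" using Sp3.one_closed by simp
  moreover have "proj (A ^\<^sub>m (5 ^ n)) = proj (1\<^sub>m 6)"
    using pow A proj.hom_nat_pow[OF AS, of "5 ^ n"] proj.hom_one AS by simp
  ultimately consider "A ^\<^sub>m (5 ^ n) = 1\<^sub>m 6" | "A ^\<^sub>m (5 ^ n) = - 1\<^sub>m 6"
    by (auto simp: proj_eq_iff)
  then show ?thesis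
  proof cases
    case 1
    have "A $$ (i, i) = 1" if "i < 6" for i
      using borel_Sp_pow(2)[OF A(1) that, of "5 ^ n"] that by (simp add: 1 power_power_5)
    then show ?thesis using A by (auto simp: unipotent_Sp_def)
  next
    case 2
    have "A $$ (i, i) = - 1" if "i < 6" for i
      using borel_Sp_pow(2)[OF A(1) that, of "5 ^ n"] that by (simp add: 2 power_power_5)
    then have "- A \<in> unipotent_Sp" using neg_mem_borel[OF A(1)] cA by (auto simp: unipotent_Sp_def)
    moreover have "proj (- A) = a" using A AS neg_mem_Sp[OF AS] by (simp add: proj_eq_iff)
    ultimately show ?thesis by blast
  qed
qed

text \<open>The single element \<open>regular_mat\<close> suffices. The sign of the lift is
  harmless, since the Borel subgroup is closed under negation. The intertwining relation involves
  A^-1, so it is the inverse that is first placed in the Borel subgroup.\<close>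

lemma proj_conj_borel:
  assumes a: "a \<in> carrier (PSp 3)"
    and conj: "\<And>h. h \<in> proj ` unipotent_Sp \<Longrightarrow> a \<otimes>\<^bsub>PSp 3\<^esub> h \<otimes>\<^bsub>PSp 3\<^esub> inv\<^bsub>PSp 3\<^esub> a \<in> proj ` borel_Sp"
  shows "a \<in> proj ` borel_Sp"
proof -
  let ?r = "regular_mat :: 'a mat"
  obtain A where A: "A \<in> carrier (Sp 3)" "a = proj A" using a by (auto simp: carrier_PSp)
  let ?B = "inv\<^bsub>Sp 3\<^esub> A"
  have B: "?B \<in> carrier (Sp 3)" using A by simp
  have r: "?r \<in> carrier (Sp 3)" by (rule regular_mat_Sp)
  have "proj (A * ?r * ?B) \<in> proj ` borel_Sp"
  proof -
    have "proj (A * ?r * ?B) = a \<otimes>\<^bsub>PSp 3\<^esub> proj ?r \<otimes>\<^bsub>PSp 3\<^esub> inv\<^bsub>PSp 3\<^esub> a"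
      using proj_mult[OF A(1) r] proj_mult[OF mult_mem_Sp_3[OF A(1) r] B] proj.hom_inv[OF A(1)] A(2) by simp
    then show ?thesis using conj[of "proj ?r"] regular_mat_unipotent[where ?'a = 'a] by simp
  qed
  then obtain y where y: "y \<in> borel_Sp" "proj (A * ?r * ?B) = proj y" by blast
  then have "A * ?r * ?B = y \<or> A * ?r * ?B = - y"
    using A B r by (subst (asm) proj_eq_iff) (auto simp: mult_mem_Sp_3 borel_Sp_def)
  then have mem: "A * ?r * ?B \<in> borel_Sp" using y neg_mem_borel by auto
  have "?B \<otimes>\<^bsub>Sp 3\<^esub> (A \<otimes>\<^bsub>Sp 3\<^esub> ?r \<otimes>\<^bsub>Sp 3\<^esub> ?B) = ?r \<otimes>\<^bsub>Sp 3\<^esub> ?B"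
    using A B r by (simp add: Sp3.m_assoc[symmetric] del: Sp_3_simps)
  then have "?r * ?B = ?B * (A * ?r * ?B)" by simp
  then have "?B \<in> borel_Sp" by (rule regular_mat_conj_borel[OF B mem])
  then have "inv\<^bsub>Sp 3\<^esub> ?B \<in> borel_Sp" by (rule subgroup.m_inv_closed[OF subgroup_borel_Sp])
  then show ?thesis using A by simp
qed

text \<open>The projection is injective on unitriangular matrices, because their diagonal fixes the
  sign. Followed by the conjugation from \<open>sylow_conjugate\<close>, it is an isomorphism from
  the unitriangular group onto \<open>P\<close>.\<close>

lemma not_FSZ_sylow:
  assumes P: "sylow_subgroup 5 P (PSp 3 :: 'a mat set monoid)"
  shows "\<not> FSZ 5 ((PSp 3 :: 'a mat set monoid)\<lparr>carrier := P\<rparr>)"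
proof -
  let ?U = "unipotent_Sp :: 'a mat set"
  let ?Q = "(Sp 3 :: 'a mat monoid)\<lparr>carrier := ?U\<rparr>" and ?P = "(PSp 3 :: 'a mat set monoid)\<lparr>carrier := P\<rparr>"
  interpret Q: group ?Q using subgroup_unipotent_Sp by (rule Sp3.subgroup_imp_group)
  have "subgroup P (PSp 3)" using P by (simp add: sylow_subgroup_def)
  then have groupP: "group ?P" by (rule PSp3.subgroup_imp_group)
  obtain k where "card ?U = 5 ^ k" using card_unipotent_Sp by blast
  then have card: "card (proj ` ?U) = 5 ^ k" by (simp add: card_image inj_on_proj_unipotent)
  have U: "?U \<subseteq> carrier (Sp 3)" by (auto simp: unipotent_Sp_def borel_Sp_def)
  have prime: "Factorial_Ring.prime (5 :: nat)" by simp
  have "\<exists>x \<in> carrier (PSp 3). (\<lambda>h. inv\<^bsub>PSp 3\<^esub> x \<otimes>\<^bsub>PSp 3\<^esub> h \<otimes>\<^bsub>PSp 3\<^esub> x) ` (proj ` ?U) = P"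
  proof (rule PSp3.sylow_conjugate[OF finite_PSp prime proj.subgroup_img_is_subgroup[OF subgroup_unipotent_Sp] card
      proj.subgroup_img_is_subgroup[OF subgroup_borel_Sp] P])
    show "proj ` ?U \<subseteq> proj ` borel_Sp" by (rule image_mono) (simp add: unipotent_Sp_def)
    fix a
    show "a \<in> proj ` borel_Sp" if "a \<in> carrier (PSp 3)"
      "\<And>h. h \<in> proj ` ?U \<Longrightarrow> a \<otimes>\<^bsub>PSp 3\<^esub> h \<otimes>\<^bsub>PSp 3\<^esub> inv\<^bsub>PSp 3\<^esub> a \<in> proj ` borel_Sp"
      using that by (rule proj_conj_borel)
    show "a \<in> proj ` ?U" if "a \<in> proj ` borel_Sp" "a [^]\<^bsub>PSp 3\<^esub> ((5::nat) ^ n) = \<one>\<^bsub>PSp 3\<^esub>" for n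
      using that by (rule proj_borel_pow_eq_one)
  qed (rule bexI)
  then obtain x where x: "x \<in> carrier (PSp 3)" "(\<lambda>h. inv\<^bsub>PSp 3\<^esub> x \<otimes>\<^bsub>PSp 3\<^esub> h \<otimes>\<^bsub>PSp 3\<^esub> x) ` (proj ` ?U) = P"
    by (elim bexE)
  let ?f = "\<lambda>A. inv\<^bsub>PSp 3\<^esub> x \<otimes>\<^bsub>PSp 3\<^esub> proj A \<otimes>\<^bsub>PSp 3\<^esub> x"
  have "?f \<in> hom ?Q ?P"
  proof (rule homI)
    fix A B assume "A \<in> carrier ?Q" "B \<in> carrier ?Q"
    then have AB: "A \<in> carrier (Sp 3)" "B \<in> carrier (Sp 3)" using U by auto
    have c: "proj A \<in> carrier (PSp 3)" "proj B \<in> carrier (PSp 3)" using AB by simp_all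
    have "x \<otimes>\<^bsub>PSp 3\<^esub> (inv\<^bsub>PSp 3\<^esub> x \<otimes>\<^bsub>PSp 3\<^esub> (proj B \<otimes>\<^bsub>PSp 3\<^esub> x)) = proj B \<otimes>\<^bsub>PSp 3\<^esub> x"
      using x(1) c by (simp add: PSp3.m_assoc[symmetric])
    then have "?f A \<otimes>\<^bsub>PSp 3\<^esub> ?f B = inv\<^bsub>PSp 3\<^esub> x \<otimes>\<^bsub>PSp 3\<^esub> (proj A \<otimes>\<^bsub>PSp 3\<^esub> proj B) \<otimes>\<^bsub>PSp 3\<^esub> x"
      using x(1) c by (simp add: PSp3.m_assoc)
    then show "?f (A \<otimes>\<^bsub>?Q\<^esub> B) = ?f A \<otimes>\<^bsub>?P\<^esub> ?f B"
      using proj_mult[OF AB] by simp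
  qed (use x(2) in auto)
  moreover have "inj_on ?f ?U"
  proof (rule inj_onI)
    fix A B assume AB: "A \<in> ?U" "B \<in> ?U" "?f A = ?f B"
    then have "proj A = proj B" using x(1) U by (auto simp: subset_iff)
    then show "A = B" using AB inj_on_proj_unipotent by (auto dest: inj_onD)
  qed
  moreover have "?f ` ?U = P" using x(2) by (simp add: image_image)
  ultimately have "?f \<in> iso ?Q ?P" by (simp add: iso_def bij_betw_def)
  then show ?thesis using Q.not_FSZ_iso[OF groupP _ not_FSZ_unipotent_Sp] by blast
qed

end

theorem theorem6p1:
  assumes "CARD('a :: field) = 5"
  shows "\<not> FSZ 5 (PSp 3 :: 'a mat set monoid) \<and>
         (\<forall>P. sylow_subgroup 5 P (PSp 3 :: 'a mat set monoid) \<longrightarrow>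
              \<not> FSZ 5 ((PSp 3 :: 'a mat set monoid)\<lparr>carrier := P\<rparr>))"
proof -
  interpret card_5_field "TYPE('a)" by unfold_locales (rule assms)
  show ?thesis using not_FSZ_PSp not_FSZ_sylow by blast
qed

end
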